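(* Let $\alpha,\beta\ge0$ with $\alpha+\beta>0$. The operator $A^\perp_{\alpha,\beta}$ in $\mathfrak C_{\mathrm{ov}}(\mathbb R_\sharp)$ generates the cosine family $\{\mathrm{Cos}^\perp_{\alpha,\beta}(t),\,t\in\mathbb R\}$ given by $$\mathrm{Cos}^\perp_{\alpha,\beta}(t)=R\,C_{\mathrm D}(t)\,E^\perp_{\alpha,\beta},\qquad t\in\mathbb R.$$
   Context: $\mathfrak C[-\infty,\infty]$ is the space of real continuous functions on $\mathbb R$ with finite limits at $\pm\infty$ (supremum norm); $\mathcal C=(\mathfrak C[-\infty,\infty])^2$. $\mathfrak C(\mathbb R_\sharp)$ is the Banach space (supremum norm) of real continuous functions on $(-\infty,0)\cup(0,\infty)$ with finite limits at $\pm\infty$ and finite one-sided limits $f(0-),f(0+)$ at $0$. $\mathfrak C_{\mathrm{ov}}(\mathbb R_\sharp)$ is its subspace of functions with $f(0+)=-f(0-)$. $A^\perp_{\alpha,\beta}f=f''$ on the domain consisting of $f\in\mathfrak C_{\mathrm{ov}}(\mathbb R_\sharp)$ such that: (a) $f$ is twice continuously differentiable in both $(-\infty,0]$ and $[0,\infty)$, separately, with left-hand and right-hand derivatives at $0$, respectively (where the two parts of $f$ are given at $0$ the values $f(0-)$ and $f(0+)$, respectively); (b) the limits $\lim_{x\to\infty}f''(x)$ and $\lim_{x\to-\infty}f''(x)$ exist and are finite; (c) $f''(0+)=\alpha f'(0-)+\beta f'(0+)$ and $f''(0+)=-f''(0-)$. $C(t)f(x)=\frac12[f(x+t)+f(x-t)]$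 and $C_{\mathrm D}(t)(f_1,f_2)=(C(t)f_1,C(t)f_2)$ on $\mathcal C$. $R$ maps $(f_1,f_2)\in\mathcal C$ to the function $f\in\mathfrak C(\mathbb R_\sharp)$ with $f(x)=f_1(x)$ for $x<0$, $f(x)=f_2(x)$ for $x>0$. $E^\perp_{\alpha,\beta}:\mathfrak C_{\mathrm{ov}}(\mathbb R_\sharp)\to\mathcal C$, $E^\perp_{\alpha,\beta}f=(\widetilde{f_\ell},\widetilde{f_{\mathrm r}})$, is given for $x>0$ by $$\widetilde{f_\ell}(-x)=f(-x),\qquad\widetilde{f_{\mathrm r}}(x)=f(x),$$ $$\widetilde{f_\ell}(x)=-f(-x)-2f(0+)e^{-(\alpha+\beta)x}-2\int_0^xe^{-(\alpha+\beta)(x-y)}[\beta f(y)-\alpha f(-y)]\,dy,$$ $$\widetilde{f_{\mathrm r}}(-x)=-f(x)+2f(0+)e^{-(\alpha+\beta)x}+2\int_0^xe^{-(\alpha+\beta)(x-y)}[\beta f(y)-\alpha f(-y)]\,dy,$$ and $\widetilde{f_\ell}(0)=f(0-)$, $\widetilde{f_{\mathrm r}}(0)=f(0+)$. A strongly continuous cosine family in a Banach space is a strongly continuous family $\{\mathrm{Cos}(t)\}_{t\in\mathbb R}$ of bounded operators with $\mathrm{Cos}(0)=I$ and $2\,\mathrm{Cos}(t)\mathrm{Cos}(s)=\mathrm{Cos}(t+s)+\mathrm{Cos}(t-s)$; its generator is $Gf=\lim_{t\to0}2t^{-2}(\mathrm{Cos}(t)f-f)$, with domain the set of $f$ for which this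 limit exists. *)

theory Defs
  imports "HOL-Analysis.Analysis" "HOL-Real_Asymp.Real_Asymp"
begin

section \<open>Cosine families in Banach spaces\<close>

definition cosine_family :: "(real \<Rightarrow> 'a::banach \<Rightarrow> 'a) \<Rightarrow> bool" where
  "cosine_family C \<longleftrightarrow>
     (\<forall>t. bounded_linear (C t)) \<and>
     (\<forall>f. continuous_on UNIV (\<lambda>t. C t f)) \<and>
     (\<forall>f. C 0 f = f) \<and>
     (\<forall>t s f. 2 *\<^sub>R C t (C s f) = C (t + s) f + C (t - s) f)"

text \<open>Unbounded operators are represented by their graphs; the domain of \<open>A\<close> is \<open>Domain A\<close>.\<close>

definition cosine_generator :: "(real \<Rightarrow> 'a::banach \<Rightarrow> 'a) \<Rightarrow> ('a \<times> 'a) set" where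
  "cosine_generator C = {(f, g). ((\<lambda>t. (2 / t\<^sup>2) *\<^sub>R (C t f - f)) \<longlongrightarrow> g) (at 0)}"

definition generates_cosine_family ::
    "('a::banach \<times> 'a) set \<Rightarrow> (real \<Rightarrow> 'a \<Rightarrow> 'a) \<Rightarrow> bool" where
  "generates_cosine_family A C \<longleftrightarrow> cosine_family C \<and> cosine_generator C = A"


section \<open>Uniform limits of bounded functions\<close>

lemma uniform_limit_has_limit:
  fixes f :: "nat \<Rightarrow> real \<Rightarrow> real"
  assumes u: "uniform_limit UNIV f g sequentially"
    and l: "\<And>n. \<exists>l. (f n \<longlongrightarrow> l) F" and F: "F \<noteq> bot"
  shows "\<exists>l. (g \<longlongrightarrow> l) F"
proof -
  obtain L where L: "\<And>n. (f n \<longlongrightarrow> L n) F" using l by metis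
  have "Cauchy L"
  proof (rule metric_CauchyI)
    fix e :: real assume e: "e > 0"
    have "eventually (\<lambda>n. \<forall>x\<in>UNIV. dist (f n x) (g x) < e/4) sequentially"
      by (rule uniform_limitD[OF u]) (use e in simp)
    then obtain N where N: "\<And>n x. n \<ge> N \<Longrightarrow> dist (f n x) (g x) < e/4"
      by (auto simp: eventually_sequentially)
    have "dist (L m) (L n) < e" if mn: "m \<ge> N" "n \<ge> N" for m n
    proof -
      have "((\<lambda>x. dist (f m x) (f n x)) \<longlongrightarrow> dist (L m) (L n)) F"
        by (intro tendsto_intros L)
      moreover have "dist (f m x) (f n x) \<le> e/2" for x
        using N[OF mn(1), of x] N[OF mn(2), of x]
          dist_triangle2[of "f m x" "f n x" "g x"] by linarith
      ultimately have "dist (L m) (L n) \<le> e/2"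
        by (intro tendsto_upperbound[OF _ _ F]) auto
      then show ?thesis using e by simp
    qed
    then show "\<exists>M. \<forall>m\<ge>M. \<forall>n\<ge>M. dist (L m) (L n) < e" by blast
  qed
  then obtain l where l: "L \<longlonglongrightarrow> l" using Cauchy_convergent convergent_def by blast
  have "(g \<longlongrightarrow> l) F"
    by (rule swap_uniform_limit'[OF _ l u _ sequentially_bot]) (use L in auto)
  then show ?thesis by blast
qed

lemma sup_norm_triangle:
  fixes f g :: "real \<Rightarrow> real"
  assumes "bounded (f ` S)" "bounded (g ` S)" "S \<noteq> {}"
  shows "(SUP x\<in>S. \<bar>f x + g x\<bar>) \<le> (SUP x\<in>S. \<bar>f x\<bar>) + (SUP x\<in>S. \<bar>g x\<bar>)"
proof (rule cSUP_least[OF assms(3)])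
  fix x assume x: "x \<in> S"
  have bd: "bdd_above ((\<lambda>x. \<bar>h x\<bar>) ` S)" if b: "bounded (h ` S)" for h :: "real \<Rightarrow> real"
  proof -
    obtain B where "\<And>x. x \<in> S \<Longrightarrow> \<bar>h x\<bar> \<le> B" using b by (auto simp: bounded_iff)
    then show ?thesis by (rule bdd_aboveI2)
  qed
  have "\<bar>f x\<bar> \<le> (SUP x\<in>S. \<bar>f x\<bar>)" "\<bar>g x\<bar> \<le> (SUP x\<in>S. \<bar>g x\<bar>)"
    by (intro cSUP_upper x bd assms)+
  then show "\<bar>f x + g x\<bar> \<le> (SUP x\<in>S. \<bar>f x\<bar>) + (SUP x\<in>S. \<bar>g x\<bar>)" by linarith
qed

lemma sup_norm_upper:
  fixes f :: "real \<Rightarrow> real"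
  assumes "bounded (f ` S)" "x \<in> S"
  shows "\<bar>f x\<bar> \<le> (SUP x\<in>S. \<bar>f x\<bar>)"
proof -
  obtain B where "\<And>x. x \<in> S \<Longrightarrow> \<bar>f x\<bar> \<le> B" using assms by (auto simp: bounded_iff)
  then have "bdd_above ((\<lambda>x. \<bar>f x\<bar>) ` S)" by (rule bdd_aboveI2)
  then show ?thesis by (intro cSUP_upper assms)
qed

lemma sup_norm_scale:
  fixes f :: "real \<Rightarrow> real"
  assumes b: "bounded (f ` S)" "S \<noteq> {}"
  shows "(SUP x\<in>S. \<bar>a * f x\<bar>) = \<bar>a\<bar> * (SUP x\<in>S. \<bar>f x\<bar>)"
proof (cases "a = 0")
  case True
  then show ?thesis using assms by simp
next
  case False
  show ?thesis
  proof (rule antisym)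
    show "(SUP x\<in>S. \<bar>a * f x\<bar>) \<le> \<bar>a\<bar> * (SUP x\<in>S. \<bar>f x\<bar>)"
      by (intro cSUP_least b) (auto simp: abs_mult intro!: mult_left_mono sup_norm_upper b)
    have b': "bounded ((\<lambda>x. a * f x) ` S)"
      using bounded_scaling[OF b(1), of a] by (simp add: image_image)
    have "(SUP x\<in>S. \<bar>f x\<bar>) \<le> (SUP x\<in>S. \<bar>a * f x\<bar>) / \<bar>a\<bar>"
    proof (intro cSUP_least b)
      fix x assume "x \<in> S"
      then show "\<bar>f x\<bar> \<le> (SUP x\<in>S. \<bar>a * f x\<bar>) / \<bar>a\<bar>"
        using sup_norm_upper[OF b', of x] False by (simp add: abs_mult field_simps)
    qed
    then show "\<bar>a\<bar> * (SUP x\<in>S. \<bar>f x\<bar>) \<le> (SUP x\<in>S. \<bar>a * f x\<bar>)"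
      using False by (simp add: field_simps)
  qed
qed


section \<open>The space of continuous functions on the line with limits at both infinities\<close>

definition cinf_set :: "(real \<Rightarrow> real) set" where
  "cinf_set = {f. continuous_on UNIV f \<and> (\<exists>l. (f \<longlongrightarrow> l) at_top) \<and> (\<exists>l. (f \<longlongrightarrow> l) at_bot)}"

typedef cinf = cinf_set
  morphisms apply_cinf Cinf
  by (rule exI[of _ "\<lambda>_. 0"]) (auto simp: cinf_set_def)

setup_lifting type_definition_cinf

lemma cinf_eqI: "(\<And>x. apply_cinf f x = apply_cinf g x) \<Longrightarrow> f = g"
  by transfer auto

lemma cinf_set_bounded:
  assumes "f \<in> cinf_set"
  shows "bounded (range f)"
proof -
  from assms obtain l m where c: "continuous_on UNIV f"
    and l: "(f \<longlongrightarrow> l) at_top" and m: "(f \<longlongrightarrow> m) at_bot"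
    by (auto simp: cinf_set_def)
  have "eventually (\<lambda>x. dist (f x) l < 1) at_top" using l by (rule tendstoD) simp
  then obtain b where b: "\<And>x. x \<ge> b \<Longrightarrow> dist (f x) l < 1"
    by (auto simp: eventually_at_top_linorder)
  have "eventually (\<lambda>x. dist (f x) m < 1) at_bot" using m by (rule tendstoD) simp
  then obtain a where a: "\<And>x. x \<le> a \<Longrightarrow> dist (f x) m < 1"
    by (auto simp: eventually_at_bot_linorder)
  have "bounded (f ` {a..b})"
    by (intro compact_imp_bounded compact_continuous_image continuous_on_subset[OF c]) auto
  then have "bounded (f ` {a..b} \<union> ball l 1 \<union> ball m 1)" by simp
  moreover have "range f \<subseteq> f ` {a..b} \<union> ball l 1 \<union> ball m 1"
  proof safe
    fix x assume "f x \<notin> ball m 1" "f x \<notin> ball l 1"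
    then have "\<not> x \<le> a" "\<not> x \<ge> b" using a[of x] b[of x] by (auto simp: dist_commute)
    then show "f x \<in> f ` {a..b}" by auto
  qed
  ultimately show ?thesis by (rule bounded_subset)
qed

instantiation cinf :: real_normed_vector
begin

lift_definition zero_cinf :: cinf is "\<lambda>_. 0"
  by (auto simp: cinf_set_def)
lift_definition plus_cinf :: "cinf \<Rightarrow> cinf \<Rightarrow> cinf" is "\<lambda>f g x. f x + g x"
  by (auto simp: cinf_set_def intro!: continuous_intros intro: tendsto_add)
lift_definition minus_cinf :: "cinf \<Rightarrow> cinf \<Rightarrow> cinf" is "\<lambda>f g x. f x - g x"
  by (auto simp: cinf_set_def intro!: continuous_intros intro: tendsto_diff)
lift_definition uminus_cinf :: "cinf \<Rightarrow> cinf" is "\<lambda>f x. - f x"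
  by (auto simp: cinf_set_def intro!: continuous_intros intro: tendsto_minus)
lift_definition scaleR_cinf :: "real \<Rightarrow> cinf \<Rightarrow> cinf" is "\<lambda>a f x. a * f x"
  by (auto simp: cinf_set_def intro!: continuous_intros intro: tendsto_mult_left)

lift_definition norm_cinf :: "cinf \<Rightarrow> real" is "\<lambda>f. SUP x. \<bar>f x\<bar>" .

definition dist_cinf :: "cinf \<Rightarrow> cinf \<Rightarrow> real" where "dist_cinf f g = norm (f - g)"
definition sgn_cinf :: "cinf \<Rightarrow> cinf" where "sgn_cinf f = inverse (norm f) *\<^sub>R f"
definition uniformity_cinf :: "(cinf \<times> cinf) filter" where
  "uniformity_cinf = (INF e\<in>{0 <..}. principal {(x, y). dist x y < e})"
definition open_cinf :: "cinf set \<Rightarrow> bool" where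
  "open_cinf S = (\<forall>x\<in>S. \<forall>\<^sub>F (x', y) in uniformity. x' = x \<longrightarrow> y \<in> S)"

lemma norm_cinf_upper: "\<bar>apply_cinf f x\<bar> \<le> norm f"
  by transfer (auto intro: sup_norm_upper cinf_set_bounded)

instance
proof
  fix a b :: real and f g h :: cinf
  show "norm f = 0 \<longleftrightarrow> f = 0"
  proof
    assume "norm f = 0"
    then have "apply_cinf f x = 0" for x using norm_cinf_upper[of f x] by simp
    then show "f = 0" by (intro cinf_eqI) (simp add: zero_cinf.rep_eq)
  qed (simp add: norm_cinf.rep_eq zero_cinf.rep_eq)
  show "norm (f + g) \<le> norm f + norm g"
    by transfer (auto intro: sup_norm_triangle cinf_set_bounded)
  show "norm (a *\<^sub>R f) = \<bar>a\<bar> * norm f"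
    by transfer (auto intro: sup_norm_scale cinf_set_bounded)
qed (rule dist_cinf_def sgn_cinf_def uniformity_cinf_def open_cinf_def
      | (rule cinf_eqI, simp add: plus_cinf.rep_eq minus_cinf.rep_eq uminus_cinf.rep_eq
          zero_cinf.rep_eq scaleR_cinf.rep_eq algebra_simps))+

end

instance cinf :: banach
proof
  fix X :: "nat \<Rightarrow> cinf" assume X: "Cauchy X"
  have "\<exists>g. uniform_limit UNIV (\<lambda>n. apply_cinf (X n)) g sequentially"
  proof -
    have "\<exists>l. \<forall>e>0. \<exists>N. \<forall>n x. N \<le> n \<and> True \<longrightarrow> dist (apply_cinf (X n) x) (l x) < e"
      unfolding uniformly_convergent_eq_cauchy
    proof (intro allI impI)
      fix e :: real assume "e > 0"
      then obtain M where M: "\<And>m n. m \<ge> M \<Longrightarrow> n \<ge> M \<Longrightarrow> dist (X m) (X n) < e"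
        using metric_CauchyD[OF X] by blast
      have "dist (apply_cinf (X m) x) (apply_cinf (X n) x) < e" if "m \<ge> M" "n \<ge> M" for m n x
        using M[OF that] norm_cinf_upper[of "X m - X n" x]
        by (simp add: dist_norm minus_cinf.rep_eq)
      then show "\<exists>N. \<forall>m n x. N \<le> m \<and> N \<le> n \<and> True \<longrightarrow>
          dist (apply_cinf (X m) x) (apply_cinf (X n) x) < e" by blast
    qed
    then show ?thesis unfolding uniform_limit_sequentially_iff by blast
  qed
  then obtain g where g: "uniform_limit UNIV (\<lambda>n. apply_cinf (X n)) g sequentially" by blast
  have Xn: "apply_cinf (X n) \<in> cinf_set" for n by (rule apply_cinf)
  have "continuous_on UNIV g"
    by (rule uniform_limit_theorem[OF _ g]) (use Xn in \<open>auto simp: cinf_set_def\<close>)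
  moreover have "\<exists>l. (g \<longlongrightarrow> l) at_top" "\<exists>l. (g \<longlongrightarrow> l) at_bot"
    by (rule uniform_limit_has_limit[OF g]; use Xn in \<open>auto simp: cinf_set_def\<close>)+
  ultimately have "g \<in> cinf_set" by (auto simp: cinf_set_def)
  then obtain G where G: "g = apply_cinf G" by (metis Cinf_inverse)
  have "X \<longlonglongrightarrow> G"
  proof (rule tendstoI)
    fix e :: real assume e: "e > 0"
    have "eventually (\<lambda>n. \<forall>x\<in>UNIV. dist (apply_cinf (X n) x) (g x) < e/2) sequentially"
      by (rule uniform_limitD[OF g]) (use e in simp)
    then show "eventually (\<lambda>n. dist (X n) G < e) sequentially"
    proof eventually_elim
      case (elim n)
      have "norm (X n - G) \<le> e/2"
        unfolding norm_cinf.rep_eq minus_cinf.rep_eq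
        by (intro cSUP_least) (use elim G in \<open>auto simp: dist_real_def intro: less_imp_le\<close>)
      then show ?case using e by (simp add: dist_norm)
    qed
  qed
  then show "convergent X" by (rule convergentI)
qed


section \<open>The space of continuous functions on the punctured line\<close>

text \<open>A function on \<open>\<real> \<setminus> {0}\<close> is represented by its extension to \<open>\<real>\<close> with the dummy value \<open>0\<close>
  at \<open>0\<close>; continuity, limits and norm only involve the values at \<open>x \<noteq> 0\<close>.\<close>

definition csharp_set :: "(real \<Rightarrow> real) set" where
  "csharp_set = {f. f 0 = 0 \<and> continuous_on (- {0}) f \<and>
     (\<exists>l. (f \<longlongrightarrow> l) at_top) \<and> (\<exists>l. (f \<longlongrightarrow> l) at_bot) \<and>
     (\<exists>l. (f \<longlongrightarrow> l) (at_left 0)) \<and> (\<exists>l. (f \<longlongrightarrow> l) (at_right 0))}"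

typedef csharp = csharp_set
  morphisms apply_csharp Csharp
  by (rule exI[of _ "\<lambda>_. 0"]) (auto simp: csharp_set_def)

setup_lifting type_definition_csharp

lemma apply_csharp_0: "apply_csharp f 0 = 0"
  using apply_csharp[of f] by (simp add: csharp_set_def)

lemma csharp_eqI: "(\<And>x. x \<noteq> 0 \<Longrightarrow> apply_csharp f x = apply_csharp g x) \<Longrightarrow> f = g"
  by (metis apply_csharp_0 apply_csharp_inject ext)

lemma tendsto_at_left_within: "(f \<longlongrightarrow> l) (at_left (0::real)) \<Longrightarrow> (g \<longlongrightarrow> l) (at_left 0)"
  if "\<And>x. x < 0 \<Longrightarrow> g x = f x"
  by (erule Lim_transform_eventually) (auto simp: eventually_at_filter that)

lemma tendsto_at_right_within: "(f \<longlongrightarrow> l) (at_right (0::real)) \<Longrightarrow> (g \<longlongrightarrow> l) (at_right 0)"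
  if "\<And>x. x > 0 \<Longrightarrow> g x = f x"
  by (erule Lim_transform_eventually) (auto simp: eventually_at_filter that)

lemma continuous_on_UNIV_split:
  fixes g :: "real \<Rightarrow> real"
  assumes "continuous_on {..<0} g" "continuous_on {0<..} g"
    "(g \<longlongrightarrow> g 0) (at_left 0)" "(g \<longlongrightarrow> g 0) (at_right 0)"
  shows "continuous_on UNIV g"
proof -
  have "isCont g x" for x
  proof (cases x "0 :: real" rule: linorder_cases)
    case less then show ?thesis using assms(1) by (simp add: continuous_on_eq_continuous_at)
  next
    case greater then show ?thesis using assms(2) by (simp add: continuous_on_eq_continuous_at)
  next
    case equal then show ?thesis using assms(3,4) by (simp add: isCont_def filterlim_at_split)
  qed
  then show ?thesis by (simp add: continuous_at_imp_continuous_on)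
qed

lemma csharp_set_right_ext:
  assumes f: "f \<in> csharp_set" and l: "(f \<longlongrightarrow> l) (at_right 0)"
  shows "(\<lambda>x. if x > 0 then f x else l) \<in> cinf_set"
proof -
  let ?g = "\<lambda>x. if x > 0 then f x else l"
  have "continuous_on {0<..} ?g"
    by (rule continuous_on_eq[of _ f])
       (use f in \<open>auto simp: csharp_set_def intro: continuous_on_subset\<close>)
  moreover have "continuous_on {..<0} ?g"
    by (rule continuous_on_eq[of _ "\<lambda>_. l"]) auto
  moreover have "(?g \<longlongrightarrow> l) (at_right 0)"
    by (rule tendsto_at_right_within[OF _ l]) auto
  moreover have "(?g \<longlongrightarrow> l) (at_left 0)"
    by (rule tendsto_at_left_within[of _ "\<lambda>_. l"]) auto
  ultimately have "continuous_on UNIV ?g"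
    by (intro continuous_on_UNIV_split) auto
  moreover obtain m where "(f \<longlongrightarrow> m) at_top" using f by (auto simp: csharp_set_def)
  then have "(?g \<longlongrightarrow> m) at_top"
    by (rule Lim_transform_eventually) (use eventually_gt_at_top[of 0] in eventually_elim, auto)
  moreover have "(?g \<longlongrightarrow> l) at_bot"
    by (rule tendsto_eventually) (use eventually_gt_at_bot[of 0] in eventually_elim, auto)
  ultimately show ?thesis by (auto simp: cinf_set_def)
qed

lemma csharp_set_left_ext:
  assumes f: "f \<in> csharp_set" and l: "(f \<longlongrightarrow> l) (at_left 0)"
  shows "(\<lambda>x. if x < 0 then f x else l) \<in> cinf_set"
proof -
  let ?g = "\<lambda>x. if x < 0 then f x else l"
  have "continuous_on {..<0} ?g"
    by (rule continuous_on_eq[of _ f])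
       (use f in \<open>auto simp: csharp_set_def intro: continuous_on_subset\<close>)
  moreover have "continuous_on {0<..} ?g"
    by (rule continuous_on_eq[of _ "\<lambda>_. l"]) auto
  moreover have "(?g \<longlongrightarrow> l) (at_left 0)"
    by (rule tendsto_at_left_within[OF _ l]) auto
  moreover have "(?g \<longlongrightarrow> l) (at_right 0)"
    by (rule tendsto_at_right_within[of _ "\<lambda>_. l"]) auto
  ultimately have "continuous_on UNIV ?g"
    by (intro continuous_on_UNIV_split) auto
  moreover obtain m where "(f \<longlongrightarrow> m) at_bot" using f by (auto simp: csharp_set_def)
  then have "(?g \<longlongrightarrow> m) at_bot"
    by (rule Lim_transform_eventually) (use eventually_gt_at_bot[of 0] in eventually_elim, auto)
  moreover have "(?g \<longlongrightarrow> l) at_top"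
    by (rule tendsto_eventually) (use eventually_gt_at_top[of 0] in eventually_elim, auto)
  ultimately show ?thesis by (auto simp: cinf_set_def)
qed

lemma csharp_set_bounded:
  assumes f: "f \<in> csharp_set"
  shows "bounded (f ` (- {0}))"
proof -
  obtain l r where "(f \<longlongrightarrow> l) (at_left 0)" "(f \<longlongrightarrow> r) (at_right 0)"
    using f by (auto simp: csharp_set_def)
  then have "bounded (range (\<lambda>x. if x < 0 then f x else l) \<union> range (\<lambda>x. if x > 0 then f x else r))"
    by (intro iffD2[OF bounded_Un] conjI cinf_set_bounded csharp_set_left_ext csharp_set_right_ext f)
  moreover have "f ` (- {0}) \<subseteq> range (\<lambda>x. if x < 0 then f x else l) \<union> range (\<lambda>x. if x > 0 then f x else r)"
  proof (rule image_subsetI)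
    fix x :: real assume "x \<in> - {0}"
    then consider "x < 0" | "x > 0" by fastforce
    then show "f x \<in> range (\<lambda>x. if x < 0 then f x else l) \<union> range (\<lambda>x. if x > 0 then f x else r)"
    proof cases
      case 1 then show ?thesis by (intro UnI1 image_eqI[of _ _ x]) auto
    next
      case 2 then show ?thesis by (intro UnI2 image_eqI[of _ _ x]) auto
    qed
  qed
  ultimately show ?thesis by (rule bounded_subset)
qed

instantiation csharp :: real_normed_vector
begin

lift_definition zero_csharp :: csharp is "\<lambda>_. 0"
  by (auto simp: csharp_set_def)
lift_definition plus_csharp :: "csharp \<Rightarrow> csharp \<Rightarrow> csharp" is "\<lambda>f g x. f x + g x"
  by (auto simp: csharp_set_def intro!: continuous_intros intro: tendsto_add)
lift_definition minus_csharp :: "csharp \<Rightarrow> csharp \<Rightarrow> csharp" is "\<lambda>f g x. f x - g x"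
  by (auto simp: csharp_set_def intro!: continuous_intros intro: tendsto_diff)
lift_definition uminus_csharp :: "csharp \<Rightarrow> csharp" is "\<lambda>f x. - f x"
  by (auto simp: csharp_set_def intro!: continuous_intros intro: tendsto_minus)
lift_definition scaleR_csharp :: "real \<Rightarrow> csharp \<Rightarrow> csharp" is "\<lambda>a f x. a * f x"
  by (auto simp: csharp_set_def intro!: continuous_intros intro: tendsto_mult_left)

lift_definition norm_csharp :: "csharp \<Rightarrow> real" is "\<lambda>f. SUP x\<in>- {0}. \<bar>f x\<bar>" .

definition dist_csharp :: "csharp \<Rightarrow> csharp \<Rightarrow> real" where "dist_csharp f g = norm (f - g)"
definition sgn_csharp :: "csharp \<Rightarrow> csharp" where "sgn_csharp f = inverse (norm f) *\<^sub>R f"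
definition uniformity_csharp :: "(csharp \<times> csharp) filter" where
  "uniformity_csharp = (INF e\<in>{0 <..}. principal {(x, y). dist x y < e})"
definition open_csharp :: "csharp set \<Rightarrow> bool" where
  "open_csharp S = (\<forall>x\<in>S. \<forall>\<^sub>F (x', y) in uniformity. x' = x \<longrightarrow> y \<in> S)"

lemma punctured_line_nonempty: "- {0::real} \<noteq> {}"
proof -
  have "1 \<in> - {0::real}" by simp
  then show ?thesis by blast
qed

lemma norm_csharp_upper: "x \<noteq> 0 \<Longrightarrow> \<bar>apply_csharp f x\<bar> \<le> norm f"
  by transfer (auto intro: sup_norm_upper csharp_set_bounded)

instance
proof
  fix a b :: real and f g h :: csharp
  show "norm f = 0 \<longleftrightarrow> f = 0"
  proof
    assume "norm f = 0"
    then have "apply_csharp f x = 0" if "x \<noteq> 0" for x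
      using norm_csharp_upper[OF that, of f] by simp
    then show "f = 0" by (intro csharp_eqI) (simp add: zero_csharp.rep_eq)
  qed (use punctured_line_nonempty in \<open>simp add: norm_csharp.rep_eq zero_csharp.rep_eq\<close>)
  show "norm (f + g) \<le> norm f + norm g"
    by transfer (intro sup_norm_triangle csharp_set_bounded punctured_line_nonempty)
  show "norm (a *\<^sub>R f) = \<bar>a\<bar> * norm f"
    by transfer (intro sup_norm_scale csharp_set_bounded punctured_line_nonempty)
qed (rule dist_csharp_def sgn_csharp_def uniformity_csharp_def open_csharp_def
      | (rule csharp_eqI, simp add: plus_csharp.rep_eq minus_csharp.rep_eq uminus_csharp.rep_eq
          zero_csharp.rep_eq scaleR_csharp.rep_eq algebra_simps))+

end

instance csharp :: banach
proof
  fix X :: "nat \<Rightarrow> csharp" assume X: "Cauchy X"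
  have "\<exists>g. uniform_limit UNIV (\<lambda>n. apply_csharp (X n)) g sequentially"
  proof -
    have "\<exists>l. \<forall>e>0. \<exists>N. \<forall>n x. N \<le> n \<and> True \<longrightarrow> dist (apply_csharp (X n) x) (l x) < e"
      unfolding uniformly_convergent_eq_cauchy
    proof (intro allI impI)
      fix e :: real assume e: "e > 0"
      then obtain M where M: "\<And>m n. m \<ge> M \<Longrightarrow> n \<ge> M \<Longrightarrow> dist (X m) (X n) < e"
        using metric_CauchyD[OF X] by blast
      have "dist (apply_csharp (X m) x) (apply_csharp (X n) x) < e" if "m \<ge> M" "n \<ge> M" for m n x
        using M[OF that] norm_csharp_upper[of x "X m - X n"] e
        by (cases "x = 0") (auto simp: dist_norm minus_csharp.rep_eq apply_csharp_0)
      then show "\<exists>N. \<forall>m n x. N \<le> m \<and> N \<le> n \<and> True \<longrightarrow>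
          dist (apply_csharp (X m) x) (apply_csharp (X n) x) < e" by blast
    qed
    then show ?thesis unfolding uniform_limit_sequentially_iff by blast
  qed
  then obtain g where g: "uniform_limit UNIV (\<lambda>n. apply_csharp (X n)) g sequentially" by blast
  have Xn: "apply_csharp (X n) \<in> csharp_set" for n by (rule apply_csharp)
  have "continuous_on (- {0}) g"
    by (rule uniform_limit_theorem[OF _ uniform_limit_on_subset[OF g]])
       (use Xn in \<open>auto simp: csharp_set_def\<close>)
  moreover have "\<exists>l. (g \<longlongrightarrow> l) at_top" "\<exists>l. (g \<longlongrightarrow> l) at_bot"
    "\<exists>l. (g \<longlongrightarrow> l) (at_left 0)" "\<exists>l. (g \<longlongrightarrow> l) (at_right 0)"
    by (rule uniform_limit_has_limit[OF g]; use Xn in \<open>auto simp: csharp_set_def\<close>)+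
  moreover have "g 0 = 0"
    using tendsto_uniform_limitI[OF g, of 0] by (simp add: apply_csharp_0 LIMSEQ_const_iff)
  ultimately have "g \<in> csharp_set" by (auto simp: csharp_set_def)
  then obtain G where G: "g = apply_csharp G" by (metis Csharp_inverse)
  have "X \<longlonglongrightarrow> G"
  proof (rule tendstoI)
    fix e :: real assume e: "e > 0"
    have "eventually (\<lambda>n. \<forall>x\<in>UNIV. dist (apply_csharp (X n) x) (g x) < e/2) sequentially"
      by (rule uniform_limitD[OF g]) (use e in simp)
    then show "eventually (\<lambda>n. dist (X n) G < e) sequentially"
    proof eventually_elim
      case (elim n)
      have "norm (X n - G) \<le> e/2"
        unfolding norm_csharp.rep_eq minus_csharp.rep_eq
        by (intro cSUP_least punctured_line_nonempty)
           (use elim G in \<open>auto simp: dist_real_def intro: less_imp_le\<close>)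
      then show ?case using e by (simp add: dist_norm)
    qed
  qed
  then show "convergent X" by (rule convergentI)
qed

text \<open>The one-sided limits \<open>f(0-)\<close> and \<open>f(0+)\<close>.\<close>

definition zero_minus :: "csharp \<Rightarrow> real" where
  "zero_minus f = Lim (at_left 0) (apply_csharp f)"

definition zero_plus :: "csharp \<Rightarrow> real" where
  "zero_plus f = Lim (at_right 0) (apply_csharp f)"

lemma tendsto_zero_minus: "(apply_csharp f \<longlongrightarrow> zero_minus f) (at_left 0)"
proof -
  obtain l where "(apply_csharp f \<longlongrightarrow> l) (at_left 0)"
    using apply_csharp[of f] by (auto simp: csharp_set_def)
  then show ?thesis unfolding zero_minus_def
    by (metis tendsto_Lim trivial_limit_at_left_real)
qed

lemma tendsto_zero_plus: "(apply_csharp f \<longlongrightarrow> zero_plus f) (at_right 0)"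
proof -
  obtain l where "(apply_csharp f \<longlongrightarrow> l) (at_right 0)"
    using apply_csharp[of f] by (auto simp: csharp_set_def)
  then show ?thesis unfolding zero_plus_def
    by (metis tendsto_Lim trivial_limit_at_right_real)
qed

lemma zero_minus_eqI: "(apply_csharp f \<longlongrightarrow> l) (at_left 0) \<Longrightarrow> zero_minus f = l"
  unfolding zero_minus_def by (metis tendsto_Lim trivial_limit_at_left_real)

lemma zero_plus_eqI: "(apply_csharp f \<longlongrightarrow> l) (at_right 0) \<Longrightarrow> zero_plus f = l"
  unfolding zero_plus_def by (metis tendsto_Lim trivial_limit_at_right_real)

lemma bounded_linear_zero_minus: "bounded_linear zero_minus"
proof (rule bounded_linear_intro[where K = 1])
  fix f g :: csharp and r :: real
  show "zero_minus (f + g) = zero_minus f + zero_minus g"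
    by (rule zero_minus_eqI) (simp add: plus_csharp.rep_eq tendsto_add tendsto_zero_minus)
  show "zero_minus (r *\<^sub>R f) = r *\<^sub>R zero_minus f"
    by (rule zero_minus_eqI) (simp add: scaleR_csharp.rep_eq tendsto_mult_left tendsto_zero_minus)
  have "\<forall>\<^sub>F x in at_left 0. norm (apply_csharp f x) \<le> norm f"
    by (auto simp: eventually_at_filter norm_csharp_upper)
  then show "norm (zero_minus f) \<le> norm f * 1"
    using tendsto_upperbound[OF tendsto_norm[OF tendsto_zero_minus]] by simp
qed

lemma bounded_linear_zero_plus: "bounded_linear zero_plus"
proof (rule bounded_linear_intro[where K = 1])
  fix f g :: csharp and r :: real
  show "zero_plus (f + g) = zero_plus f + zero_plus g"
    by (rule zero_plus_eqI) (simp add: plus_csharp.rep_eq tendsto_add tendsto_zero_plus)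
  show "zero_plus (r *\<^sub>R f) = r *\<^sub>R zero_plus f"
    by (rule zero_plus_eqI) (simp add: scaleR_csharp.rep_eq tendsto_mult_left tendsto_zero_plus)
  have "\<forall>\<^sub>F x in at_right 0. norm (apply_csharp f x) \<le> norm f"
    by (auto simp: eventually_at_filter norm_csharp_upper)
  then show "norm (zero_plus f) \<le> norm f * 1"
    using tendsto_upperbound[OF tendsto_norm[OF tendsto_zero_plus]] by simp
qed


lemmas zero_limits_linear =
  bounded_linear_zero_minus[THEN bounded_linear.linear, THEN linear_0]
  bounded_linear_zero_plus[THEN bounded_linear.linear, THEN linear_0]
  bounded_linear_zero_minus[THEN bounded_linear.linear, THEN linear_add]
  bounded_linear_zero_plus[THEN bounded_linear.linear, THEN linear_add]
  bounded_linear_zero_minus[THEN bounded_linear.linear, THEN linear_diff]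
  bounded_linear_zero_plus[THEN bounded_linear.linear, THEN linear_diff]
  bounded_linear_zero_minus[THEN bounded_linear.linear, THEN linear_neg]
  bounded_linear_zero_plus[THEN bounded_linear.linear, THEN linear_neg]
  bounded_linear_zero_minus[THEN bounded_linear.linear, THEN linear_scale]
  bounded_linear_zero_plus[THEN bounded_linear.linear, THEN linear_scale]


section \<open>The subspace of functions with \<open>f(0+) = - f(0-)\<close>\<close>

typedef cov = "{f :: csharp. zero_plus f = - zero_minus f}"
  morphisms csharp_of_cov Cov
  by (rule exI[of _ 0])
     (simp add: zero_limits_linear)

setup_lifting type_definition_cov

instantiation cov :: real_normed_vector
begin

lift_definition zero_cov :: cov is 0
  by (simp add: zero_limits_linear)
lift_definition plus_cov :: "cov \<Rightarrow> cov \<Rightarrow> cov" is "(+)"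
  by (simp add: zero_limits_linear)
lift_definition minus_cov :: "cov \<Rightarrow> cov \<Rightarrow> cov" is "(-)"
  by (simp add: zero_limits_linear)
lift_definition uminus_cov :: "cov \<Rightarrow> cov" is uminus
  by (simp add: zero_limits_linear)
lift_definition scaleR_cov :: "real \<Rightarrow> cov \<Rightarrow> cov" is "(*\<^sub>R)"
  by (simp add: zero_limits_linear)

lift_definition norm_cov :: "cov \<Rightarrow> real" is norm .

definition dist_cov :: "cov \<Rightarrow> cov \<Rightarrow> real" where "dist_cov f g = norm (f - g)"
definition sgn_cov :: "cov \<Rightarrow> cov" where "sgn_cov f = inverse (norm f) *\<^sub>R f"
definition uniformity_cov :: "(cov \<times> cov) filter" where
  "uniformity_cov = (INF e\<in>{0 <..}. principal {(x, y). dist x y < e})"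
definition open_cov :: "cov set \<Rightarrow> bool" where
  "open_cov S = (\<forall>x\<in>S. \<forall>\<^sub>F (x', y) in uniformity. x' = x \<longrightarrow> y \<in> S)"

instance
proof
  fix f g :: cov and a :: real
  show "norm (f + g) \<le> norm f + norm g" by (simp add: norm_cov.rep_eq plus_cov.rep_eq norm_triangle_ineq)
  show "norm (a *\<^sub>R f) = \<bar>a\<bar> * norm f" by (simp add: norm_cov.rep_eq scaleR_cov.rep_eq)
  show "norm f = 0 \<longleftrightarrow> f = 0"
    by (simp add: norm_cov.rep_eq zero_cov.rep_eq flip: csharp_of_cov_inject)
qed (rule dist_cov_def sgn_cov_def uniformity_cov_def open_cov_def
      | (rule csharp_of_cov_inject[THEN iffD1], simp add: plus_cov.rep_eq minus_cov.rep_eq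
          uminus_cov.rep_eq zero_cov.rep_eq scaleR_cov.rep_eq algebra_simps))+

end

instance cov :: banach
proof
  fix X :: "nat \<Rightarrow> cov" assume "Cauchy X"
  have d: "dist f g = dist (csharp_of_cov f) (csharp_of_cov g)" for f g
    by (simp add: dist_norm norm_cov.rep_eq minus_cov.rep_eq)
  have "Cauchy (\<lambda>n. csharp_of_cov (X n))" using \<open>Cauchy X\<close> by (simp add: Cauchy_def d)
  then obtain L where L: "(\<lambda>n. csharp_of_cov (X n)) \<longlonglongrightarrow> L"
    using Cauchy_convergent convergent_def by blast
  have "(\<lambda>n. zero_plus (csharp_of_cov (X n))) \<longlonglongrightarrow> zero_plus L"
    by (rule bounded_linear.tendsto[OF bounded_linear_zero_plus L])
  moreover have "(\<lambda>n. - zero_minus (csharp_of_cov (X n))) \<longlonglongrightarrow> - zero_minus L"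
    by (intro tendsto_minus bounded_linear.tendsto[OF bounded_linear_zero_minus L])
  moreover have "zero_plus (csharp_of_cov (X n)) = - zero_minus (csharp_of_cov (X n))" for n
    using csharp_of_cov[of "X n"] by simp
  ultimately have "zero_plus L = - zero_minus L" using LIMSEQ_unique by auto
  then obtain M where M: "L = csharp_of_cov M" by (metis (mono_tags) Cov_inverse mem_Collect_eq)
  have "X \<longlonglongrightarrow> M" using L by (simp add: tendsto_iff d M)
  then show "convergent X" by (rule convergentI)
qed

abbreviation apply_cov :: "cov \<Rightarrow> real \<Rightarrow> real" where
  "apply_cov f \<equiv> apply_csharp (csharp_of_cov f)"

abbreviation cov_minus :: "cov \<Rightarrow> real" where "cov_minus f \<equiv> zero_minus (csharp_of_cov f)"
abbreviation cov_plus :: "cov \<Rightarrow> real" where "cov_plus f \<equiv> zero_plus (csharp_of_cov f)"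

lemma cov_plus_eq: "cov_plus f = - cov_minus f"
  using csharp_of_cov[of f] by simp


section \<open>The operator \<open>A\<^sup>\<bottom>\<close>\<close>

text \<open>\<open>g1\<close> and \<open>g2\<close> are the first and second derivative of \<open>g\<close> on \<open>S\<close>; at an end-point of
  \<open>S\<close> the derivatives are one-sided.\<close>

definition C2_on :: "real set \<Rightarrow> (real \<Rightarrow> real) \<Rightarrow> (real \<Rightarrow> real) \<Rightarrow> (real \<Rightarrow> real) \<Rightarrow> bool" where
  "C2_on S g g1 g2 \<longleftrightarrow>
     (\<forall>x\<in>S. (g has_real_derivative g1 x) (at x within S)) \<and>
     (\<forall>x\<in>S. (g1 has_real_derivative g2 x) (at x within S)) \<and>
     continuous_on S g2"

definition left_part :: "csharp \<Rightarrow> real \<Rightarrow> real" where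
  "left_part f x = (if x < 0 then apply_csharp f x else zero_minus f)"

definition right_part :: "csharp \<Rightarrow> real \<Rightarrow> real" where
  "right_part f x = (if x > 0 then apply_csharp f x else zero_plus f)"

text \<open>Since the second derivatives are continuous up to \<open>0\<close>, \<open>l2 0\<close> and \<open>r2 0\<close> are
  \<open>f''(0-)\<close> and \<open>f''(0+)\<close>; likewise \<open>l1 0\<close> and \<open>r1 0\<close> are \<open>f'(0-)\<close> and \<open>f'(0+)\<close>.\<close>

definition A_perp_domain :: "real \<Rightarrow> real \<Rightarrow> cov set" where
  "A_perp_domain \<alpha> \<beta> = {f. \<exists>l1 l2 r1 r2.
     C2_on {..0} (left_part (csharp_of_cov f)) l1 l2 \<and>
     C2_on {0..} (right_part (csharp_of_cov f)) r1 r2 \<and>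
     (\<exists>L. (r2 \<longlongrightarrow> L) at_top) \<and> (\<exists>L. (l2 \<longlongrightarrow> L) at_bot) \<and>
     r2 0 = \<alpha> * l1 0 + \<beta> * r1 0 \<and> r2 0 = - l2 0}"

definition A_perp :: "real \<Rightarrow> real \<Rightarrow> (cov \<times> cov) set" where
  "A_perp \<alpha> \<beta> = {(f, g). f \<in> A_perp_domain \<alpha> \<beta> \<and>
     (\<forall>x. x \<noteq> 0 \<longrightarrow> apply_cov g x = deriv (deriv (apply_cov f)) x)}"

lemma C2_on_deriv2:
  assumes "C2_on S g g1 g2" "open T" "T \<subseteq> S" "x \<in> T" "\<And>y. y \<in> T \<Longrightarrow> h y = g y"
  shows "deriv (deriv h) x = g2 x"
proof -
  have at: "at y within S = at y" if "y \<in> T" for y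
    using assms(2,3) that by (metis at_within_open at_within_open_subset)
  have 1: "(h has_real_derivative g1 y) (at y)" if "y \<in> T" for y
  proof (rule has_field_derivative_transform_within_open[of g])
    show "(g has_real_derivative g1 y) (at y)"
      using assms(1,3) at[OF that] that by (force simp: C2_on_def)
  qed (use assms that in auto)
  have "(deriv h has_real_derivative g2 x) (at x)"
  proof (rule has_field_derivative_transform_within_open[of g1])
    show "(g1 has_real_derivative g2 x) (at x)"
      using assms(1,3,4) at[of x] by (force simp: C2_on_def)
  qed (use assms(2,4) DERIV_imp_deriv[OF 1, symmetric] in auto)
  then show ?thesis by (rule DERIV_imp_deriv)
qed

lemma csharp_set_glue:
  assumes "continuous_on {..0} f1" "continuous_on {0..} f2"
    "(f1 \<longlongrightarrow> a) at_bot" "(f2 \<longlongrightarrow> b) at_top"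
  defines "f \<equiv> \<lambda>x::real. if x < 0 then f1 x else if x > 0 then f2 x else (0::real)"
  shows "f \<in> csharp_set" "(f \<longlongrightarrow> f1 0) (at_left 0)" "(f \<longlongrightarrow> f2 0) (at_right 0)"
proof -
  have "(f1 \<longlongrightarrow> f1 0) (at 0 within {..0})" using assms(1) by (simp add: continuous_on_def)
  then have "(f1 \<longlongrightarrow> f1 0) (at_left 0)" by (rule tendsto_within_subset) auto
  then show L: "(f \<longlongrightarrow> f1 0) (at_left 0)"
    by (rule tendsto_at_left_within[rotated]) (simp add: f_def)
  have "(f2 \<longlongrightarrow> f2 0) (at 0 within {0..})" using assms(2) by (simp add: continuous_on_def)
  then have "(f2 \<longlongrightarrow> f2 0) (at_right 0)" by (rule tendsto_within_subset) auto
  then show R: "(f \<longlongrightarrow> f2 0) (at_right 0)"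
    by (rule tendsto_at_right_within[rotated]) (simp add: f_def)
  have "continuous_on {..<0} f"
    by (rule continuous_on_eq[of _ f1])
       (use assms(1) in \<open>auto simp: f_def intro: continuous_on_subset\<close>)
  moreover have "continuous_on {0<..} f"
    by (rule continuous_on_eq[of _ f2])
       (use assms(2) in \<open>auto simp: f_def intro: continuous_on_subset\<close>)
  ultimately have "continuous_on ({..<0} \<union> {0<..}) f"
    by (intro continuous_on_open_Un) auto
  moreover have "{..<0} \<union> {0<..} = - {0::real}" by auto
  moreover have "(f \<longlongrightarrow> a) at_bot"
    using assms(3)
    by (rule Lim_transform_eventually)
       (use eventually_gt_at_bot[of 0] in eventually_elim, auto simp: f_def)
  moreover have "(f \<longlongrightarrow> b) at_top"
    using assms(4)
    by (rule Lim_transform_eventually)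
       (use eventually_gt_at_top[of 0] in eventually_elim, auto simp: f_def)
  ultimately show "f \<in> csharp_set" using L R by (auto simp: csharp_set_def f_def)
qed

lemma Domain_A_perp: "Domain (A_perp \<alpha> \<beta>) = A_perp_domain \<alpha> \<beta>"
proof (intro equalityI subsetI)
  fix f assume f: "f \<in> A_perp_domain \<alpha> \<beta>"
  then obtain l1 l2 r1 r2 a b where
    l: "C2_on {..0} (left_part (csharp_of_cov f)) l1 l2" and
    r: "C2_on {0..} (right_part (csharp_of_cov f)) r1 r2" and
    b: "(r2 \<longlongrightarrow> b) at_top" and a: "(l2 \<longlongrightarrow> a) at_bot" and z: "r2 0 = - l2 0"
    by (auto simp: A_perp_domain_def)
  define h where "h = (\<lambda>x::real. if x < 0 then l2 x else if x > 0 then r2 x else 0)"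
  have c: "continuous_on {..0} l2" "continuous_on {0..} r2" using l r by (auto simp: C2_on_def)
  note g = csharp_set_glue[OF c a b, folded h_def]
  define H where "H = Csharp h"
  have H: "apply_csharp H = h" unfolding H_def by (rule Csharp_inverse) (rule g)
  have "zero_plus H = - zero_minus H"
    using zero_plus_eqI[of H] zero_minus_eqI[of H] g z by (simp add: H)
  then obtain G where G: "csharp_of_cov G = H" by (metis (mono_tags) Cov_inverse mem_Collect_eq)
  have "apply_cov G x = deriv (deriv (apply_cov f)) x" if x: "x \<noteq> 0" for x
  proof (cases "x < 0")
    case True
    have "deriv (deriv (apply_cov f)) x = l2 x"
      by (rule C2_on_deriv2[OF l, of "{..<0}"]) (use True in \<open>auto simp: left_part_def\<close>)
    then show ?thesis using True by (simp add: G H h_def)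
  next
    case False
    then have "x > 0" using x by simp
    have "deriv (deriv (apply_cov f)) x = r2 x"
      by (rule C2_on_deriv2[OF r, of "{0<..}"]) (use \<open>x > 0\<close> in \<open>auto simp: right_part_def\<close>)
    then show ?thesis using \<open>x > 0\<close> by (simp add: G H h_def)
  qed
  with f show "f \<in> Domain (A_perp \<alpha> \<beta>)" by (auto simp: A_perp_def)
qed (auto simp: A_perp_def)


section \<open>The operators \<open>C\<^sub>D(t)\<close>, \<open>R\<close> and \<open>E\<^sup>\<bottom>\<close>\<close>

lift_definition basic_cosine :: "real \<Rightarrow> cinf \<Rightarrow> cinf" is
  "\<lambda>t f x. 1/2 * (f (x + t) + f (x - t))"
proof -
  fix t and f :: "real \<Rightarrow> real" assume f: "f \<in> cinf_set"
  then obtain a b where ab: "(f \<longlongrightarrow> a) at_bot" "(f \<longlongrightarrow> b) at_top" and c: "continuous_on UNIV f"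
    by (auto simp: cinf_set_def)
  have "continuous_on UNIV (\<lambda>x. 1/2 * (f (x + t) + f (x - t)))"
    by (intro continuous_intros continuous_on_compose2[OF c]) auto
  moreover have "((\<lambda>x. 1/2 * (f (x + t) + f (x - t))) \<longlongrightarrow> 1/2 * (b + b)) at_top"
    by (intro tendsto_intros filterlim_compose[OF ab(2)]) real_asymp+
  moreover have "((\<lambda>x. 1/2 * (f (x + t) + f (x - t))) \<longlongrightarrow> 1/2 * (a + a)) at_bot"
    by (intro tendsto_intros filterlim_compose[OF ab(1)]) real_asymp+
  ultimately show "(\<lambda>x. 1/2 * (f (x + t) + f (x - t))) \<in> cinf_set"
    by (auto simp: cinf_set_def)
qed

definition C_D :: "real \<Rightarrow> cinf \<times> cinf \<Rightarrow> cinf \<times> cinf" where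
  "C_D t = (\<lambda>(f1, f2). (basic_cosine t f1, basic_cosine t f2))"

lift_definition glue :: "cinf \<Rightarrow> cinf \<Rightarrow> csharp" is
  "\<lambda>f1 f2 x. if x < 0 then f1 x else if x > 0 then f2 x else 0"
  by (auto simp: cinf_set_def intro!: csharp_set_glue(1) intro: continuous_on_subset)

definition R_op :: "cinf \<times> cinf \<Rightarrow> csharp" where
  "R_op = (\<lambda>(f1, f2). glue f1 f2)"

definition E_left :: "real \<Rightarrow> real \<Rightarrow> cov \<Rightarrow> real \<Rightarrow> real" where
  "E_left \<alpha> \<beta> f x =
     (if x < 0 then apply_cov f x
      else if x = 0 then cov_minus f
      else - apply_cov f (- x) - 2 * cov_plus f * exp (- (\<alpha> + \<beta>) * x)
           - 2 * integral {0..x} (\<lambda>y. exp (- (\<alpha> + \<beta>) * (x - y)) *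
                                       (\<beta> * apply_cov f y - \<alpha> * apply_cov f (- y))))"

text \<open>The values at negative arguments are given by a formula at \<open>-x\<close> with \<open>x > 0\<close>; hence
  the \<open>let\<close>.\<close>

definition E_right :: "real \<Rightarrow> real \<Rightarrow> cov \<Rightarrow> real \<Rightarrow> real" where
  "E_right \<alpha> \<beta> f z =
     (if z > 0 then apply_cov f z
      else if z = 0 then cov_plus f
      else let x = - z in
           - apply_cov f x + 2 * cov_plus f * exp (- (\<alpha> + \<beta>) * x)
           + 2 * integral {0..x} (\<lambda>y. exp (- (\<alpha> + \<beta>) * (x - y)) *
                                       (\<beta> * apply_cov f y - \<alpha> * apply_cov f (- y))))"

text \<open>The functions \<open>E_left\<close> and \<open>E_right\<close> belong to \<open>cinf_set\<close> when \<open>\<alpha> + \<beta> > 0\<close>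
  (lemma \<open>apply_E_perp\<close> below).\<close>

definition E_perp :: "real \<Rightarrow> real \<Rightarrow> cov \<Rightarrow> cinf \<times> cinf" where
  "E_perp \<alpha> \<beta> f = (Cinf (E_left \<alpha> \<beta> f), Cinf (E_right \<alpha> \<beta> f))"

text \<open>The function \<open>R C\<^sub>D(t) E\<^sup>\<bottom> f\<close> belongs to the subspace \<open>cov\<close> when \<open>\<alpha> + \<beta> > 0\<close>
  (lemma \<open>csharp_of_Cos_perp\<close> below).\<close>

definition Cos_perp :: "real \<Rightarrow> real \<Rightarrow> real \<Rightarrow> cov \<Rightarrow> cov" where
  "Cos_perp \<alpha> \<beta> t f = Cov (R_op (C_D t (E_perp \<alpha> \<beta> f)))"

definition E_int :: "real \<Rightarrow> real \<Rightarrow> cov \<Rightarrow> real \<Rightarrow> real" where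
  "E_int \<alpha> \<beta> f x = integral {0..x} (\<lambda>y. exp (- (\<alpha> + \<beta>) * (x - y)) *
                                       (\<beta> * apply_cov f y - \<alpha> * apply_cov f (- y)))"

lemma cinf_parts: "left_part f \<in> cinf_set" "right_part f \<in> cinf_set"
  using csharp_set_left_ext[OF apply_csharp tendsto_zero_minus, of f]
    csharp_set_right_ext[OF apply_csharp tendsto_zero_plus, of f]
  by (simp_all add: left_part_def[abs_def] right_part_def[abs_def])

lemma E_int_props:
  assumes c: "\<alpha> + \<beta> > 0"
  shows "continuous_on {0..} (E_int \<alpha> \<beta> f)" "\<exists>l. (E_int \<alpha> \<beta> f \<longlongrightarrow> l) at_top" "E_int \<alpha> \<beta> f 0 = 0"
proof -
  let ?c = "\<alpha> + \<beta>"
  define g where "g y = exp (?c * y) *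
    (\<beta> * right_part (csharp_of_cov f) y - \<alpha> * left_part (csharp_of_cov f) (- y))" for y
  have cr: "continuous_on UNIV (right_part (csharp_of_cov f))"
    and cl: "continuous_on UNIV (left_part (csharp_of_cov f))"
    using cinf_parts by (auto simp: cinf_set_def)
  have cg: "continuous_on UNIV g" unfolding g_def
    by (intro continuous_intros cr continuous_on_compose2[OF cl]) auto
  have eq: "E_int \<alpha> \<beta> f x = exp (- ?c * x) * integral {0..x} g" for x
  proof -
    have "E_int \<alpha> \<beta> f x = integral {0..x} (\<lambda>y. exp (- ?c * x) * g y)"
      unfolding E_int_def
      by (rule integral_spike[of "{0}"])
         (auto simp: g_def left_part_def right_part_def exp_diff exp_minus field_simps
               simp flip: exp_add)
    then show ?thesis by simp
  qed
  show "E_int \<alpha> \<beta> f 0 = 0" by (simp add: eq)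
  have ci: "continuous_on {0..b} (\<lambda>x. integral {0..x} g)" for b
    by (intro indefinite_integral_continuous_1 integrable_continuous_interval
        continuous_on_subset[OF cg]) auto
  have D: "((\<lambda>x. integral {0..x} g) has_real_derivative g x) (at x)" if "x > 0" for x
  proof -
    have "((\<lambda>x. integral {0..x} g) has_real_derivative g x) (at x within {0..x+1})"
      by (rule integral_has_real_derivative) (use that in \<open>auto intro: continuous_on_subset[OF cg]\<close>)
    then show ?thesis using that by (simp add: at_within_Icc_at)
  qed
  have "continuous_on {0..} (\<lambda>x. integral {0..x} g)"
  proof (rule continuous_on_eq_continuous_within[THEN iffD2], intro ballI)
    fix x :: real assume x: "x \<in> {0..}"
    show "continuous (at x within {0..}) (\<lambda>x. integral {0..x} g)"
    proof (cases "x = 0")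
      case True
      have "continuous (at 0 within {0..1}) (\<lambda>x. integral {0..x} g)"
        using ci[of 1] by (auto simp: continuous_on_eq_continuous_within)
      moreover have "at 0 within {0..1} = at (0::real) within {0..}"
        by (rule at_within_nhd[of _ "{..<1}"]) auto
      ultimately show ?thesis using True by simp
    next
      case False
      then have "isCont (\<lambda>x. integral {0..x} g) x" using D[of x] x DERIV_isCont by auto
      then show ?thesis by (rule continuous_at_imp_continuous_at_within)
    qed
  qed
  then show "continuous_on {0..} (E_int \<alpha> \<beta> f)"
    unfolding eq by (intro continuous_intros)
  obtain r l where r: "(right_part (csharp_of_cov f) \<longlongrightarrow> r) at_top"
    and l: "(left_part (csharp_of_cov f) \<longlongrightarrow> l) at_bot"
    using cinf_parts[of "csharp_of_cov f"] by (auto simp: cinf_set_def)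
  have "((\<lambda>x. integral {0..x} g / exp (?c * x)) \<longlongrightarrow> (\<beta> * r - \<alpha> * l) / ?c) at_top"
  proof (rule lhospital_at_top_at_top[where f' = g and g' = "\<lambda>x. ?c * exp (?c * x)"])
    show "LIM x at_top. exp (?c * x) :> at_top" using c by real_asymp
    show "\<forall>\<^sub>F x in at_top. ?c * exp (?c * x) \<noteq> 0" using c by simp
    show "\<forall>\<^sub>F x in at_top. ((\<lambda>x. integral {0..x} g) has_real_derivative g x) (at x)"
      using eventually_gt_at_top[of 0] by eventually_elim (rule D)
    show "\<forall>\<^sub>F x in at_top. ((\<lambda>x. exp (?c * x)) has_real_derivative ?c * exp (?c * x)) (at x)"
      by (auto intro!: derivative_eq_intros always_eventually)
    have "((\<lambda>x. (\<beta> * right_part (csharp_of_cov f) x - \<alpha> * left_part (csharp_of_cov f) (- x)) / ?c)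
        \<longlongrightarrow> (\<beta> * r - \<alpha> * l) / ?c) at_top"
      using c
      by (intro tendsto_intros r filterlim_compose[OF l] filterlim_uminus_at_bot_at_top) auto
    then show "((\<lambda>x. g x / (?c * exp (?c * x))) \<longlongrightarrow> (\<beta> * r - \<alpha> * l) / ?c) at_top"
      by (simp add: g_def)
  qed
  moreover have "exp (- ?c * x) = inverse (exp (?c * x))" for x
    by (metis exp_minus mult_minus_left)
  then have "(\<lambda>x. integral {0..x} g / exp (?c * x)) = E_int \<alpha> \<beta> f"
    by (simp only: eq divide_inverse mult.commute simp_thms fun_eq_iff)
  ultimately show "\<exists>l. (E_int \<alpha> \<beta> f \<longlongrightarrow> l) at_top" by auto
qed

lemma E_mem:
  assumes c: "\<alpha> + \<beta> > 0"
  shows "E_left \<alpha> \<beta> f \<in> cinf_set" "E_right \<alpha> \<beta> f \<in> cinf_set"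
proof -
  let ?l = "left_part (csharp_of_cov f)" and ?r = "right_part (csharp_of_cov f)"
  define K where "K x = 2 * cov_plus f * exp (- (\<alpha> + \<beta>) * x) + 2 * E_int \<alpha> \<beta> f x" for x
  obtain i where i: "(E_int \<alpha> \<beta> f \<longlongrightarrow> i) at_top" using E_int_props(2)[OF c] by blast
  have K0: "K 0 = 2 * cov_plus f" by (simp add: K_def E_int_props(3)[OF c])
  have cK: "continuous_on {0..} K" unfolding K_def by (intro continuous_intros E_int_props(1)[OF c])
  have "((\<lambda>x. exp (- (\<alpha> + \<beta>) * x)) \<longlongrightarrow> 0) at_top" using c by real_asymp
  then have "((\<lambda>x. K x) \<longlongrightarrow> 2 * cov_plus f * 0 + 2 * i) at_top"
    unfolding K_def by (intro tendsto_intros i)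
  then have limK: "(K \<longlongrightarrow> 2 * i) at_top" by simp
  obtain r l where lims: "(?r \<longlongrightarrow> r) at_top" "(?l \<longlongrightarrow> l) at_bot"
    using cinf_parts[of "csharp_of_cov f"] by (auto simp: cinf_set_def)
  have cr: "continuous_on UNIV ?r" and cl: "continuous_on UNIV ?l"
    using cinf_parts by (auto simp: cinf_set_def)
  have L: "E_left \<alpha> \<beta> f = (\<lambda>x. if x \<le> 0 then ?l x else - ?l (- x) - K x)"
    by (auto simp: fun_eq_iff E_left_def left_part_def K_def E_int_def)
  have R: "E_right \<alpha> \<beta> f = (\<lambda>x. if x \<le> 0 then - ?r (- x) + K (- x) else ?r x)"
    using K0 by (auto simp: fun_eq_iff E_right_def right_part_def K_def E_int_def Let_def)
  have "continuous_on ({..0} \<union> {0..}) (\<lambda>x. if x \<le> 0 then ?l x else - ?l (- x) - K x)"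
  proof (rule continuous_on_If)
    show "continuous_on {..0} ?l" by (rule continuous_on_subset[OF cl]) simp
    show "continuous_on {0..} (\<lambda>x. - ?l (- x) - K x)"
      by (intro continuous_intros cK continuous_on_compose2[OF cl]) auto
  qed (use K0 in \<open>auto simp: left_part_def cov_plus_eq\<close>)
  moreover have un: "{..0} \<union> {0..} = (UNIV :: real set)" by auto
  moreover have "((\<lambda>x. if x \<le> 0 then ?l x else - ?l (- x) - K x) \<longlongrightarrow> l) at_bot"
    using lims(2) by (rule Lim_transform_eventually)
       (use eventually_gt_at_bot[of 0] in eventually_elim, auto)
  moreover have "((\<lambda>x. - ?l (- x) - K x) \<longlongrightarrow> - l - 2 * i) at_top"
    by (intro tendsto_intros limK filterlim_compose[OF lims(2)] filterlim_uminus_at_bot_at_top)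
  then have "((\<lambda>x. if x \<le> 0 then ?l x else - ?l (- x) - K x) \<longlongrightarrow> - l - 2 * i) at_top"
    by (rule Lim_transform_eventually) (use eventually_gt_at_top[of 0] in eventually_elim, auto)
  ultimately show "E_left \<alpha> \<beta> f \<in> cinf_set" unfolding L cinf_set_def by auto
  have "continuous_on ({..0} \<union> {0..}) (\<lambda>x. if x \<le> 0 then - ?r (- x) + K (- x) else ?r x)"
  proof (rule continuous_on_If)
    show "continuous_on {0..} ?r" by (rule continuous_on_subset[OF cr]) simp
    show "continuous_on {..0} (\<lambda>x. - ?r (- x) + K (- x))"
      by (intro continuous_intros continuous_on_compose2[OF cK] continuous_on_compose2[OF cr]) auto
  qed (use K0 in \<open>auto simp: right_part_def\<close>)
  moreover have "((\<lambda>x. if x \<le> 0 then - ?r (- x) + K (- x) else ?r x) \<longlongrightarrow> r) at_top"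
    using lims(1) by (rule Lim_transform_eventually)
       (use eventually_gt_at_top[of 0] in eventually_elim, auto)
  moreover have "((\<lambda>x. - ?r (- x) + K (- x)) \<longlongrightarrow> - r + 2 * i) at_bot"
    by (intro tendsto_intros filterlim_compose[OF limK] filterlim_compose[OF lims(1)]
        filterlim_uminus_at_top_at_bot)
  then have "((\<lambda>x. if x \<le> 0 then - ?r (- x) + K (- x) else ?r x) \<longlongrightarrow> - r + 2 * i) at_bot"
    by (rule Lim_transform_eventually) (use eventually_gt_at_bot[of 0] in eventually_elim, auto)
  ultimately show "E_right \<alpha> \<beta> f \<in> cinf_set" unfolding R cinf_set_def using un by auto
qed

lemma apply_E_perp:
  assumes "\<alpha> + \<beta> > 0"
  shows "apply_cinf (fst (E_perp \<alpha> \<beta> f)) = E_left \<alpha> \<beta> f"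
    and "apply_cinf (snd (E_perp \<alpha> \<beta> f)) = E_right \<alpha> \<beta> f"
  using E_mem[OF assms] by (simp_all add: E_perp_def Cinf_inverse)

lemma R_op_one_sided_limits:
  "zero_minus (R_op p) = apply_cinf (fst p) 0" "zero_plus (R_op p) = apply_cinf (snd p) 0"
proof -
  obtain f1 f2 where p: "p = (f1, f2)" by fastforce
  obtain a b where *: "continuous_on {..0} (apply_cinf f1)" "continuous_on {0..} (apply_cinf f2)"
    "(apply_cinf f1 \<longlongrightarrow> a) at_bot" "(apply_cinf f2 \<longlongrightarrow> b) at_top"
    using apply_cinf[of f1] apply_cinf[of f2]
    by (auto simp: cinf_set_def intro: continuous_on_subset)
  show "zero_minus (R_op p) = apply_cinf (fst p) 0"
    by (rule zero_minus_eqI) (use csharp_set_glue(2)[OF *] in \<open>simp add: R_op_def p glue.rep_eq\<close>)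
  show "zero_plus (R_op p) = apply_cinf (snd p) 0"
    by (rule zero_plus_eqI) (use csharp_set_glue(3)[OF *] in \<open>simp add: R_op_def p glue.rep_eq\<close>)
qed

lemma csharp_of_Cos_perp:
  assumes "\<alpha> + \<beta> > 0"
  shows "csharp_of_cov (Cos_perp \<alpha> \<beta> t f) = R_op (C_D t (E_perp \<alpha> \<beta> f))"
proof -
  have "E_left \<alpha> \<beta> f t + E_left \<alpha> \<beta> f (- t) + E_right \<alpha> \<beta> f t + E_right \<alpha> \<beta> f (- t) = 0"
    by (cases t "0::real" rule: linorder_cases)
       (auto simp: E_left_def E_right_def Let_def cov_plus_eq)
  moreover have "zero_plus (R_op (C_D t (E_perp \<alpha> \<beta> f))) = 1/2 * (E_right \<alpha> \<beta> f t + E_right \<alpha> \<beta> f (- t))"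
    "zero_minus (R_op (C_D t (E_perp \<alpha> \<beta> f))) = 1/2 * (E_left \<alpha> \<beta> f t + E_left \<alpha> \<beta> f (- t))"
    by (simp_all add: R_op_one_sided_limits C_D_def case_prod_beta basic_cosine.rep_eq
        apply_E_perp[OF assms])
  ultimately have "zero_plus (R_op (C_D t (E_perp \<alpha> \<beta> f))) = - zero_minus (R_op (C_D t (E_perp \<alpha> \<beta> f)))"
    by argo
  then show ?thesis by (simp add: Cos_perp_def Cov_inverse)
qed

end

theory Submission
  imports Defs
begin

text \<open>
  Writing a pair \<open>(P, Q)\<close> of functions on the line as sums of even and odd parts, the formulas
  for \<open>E\<^sup>\<bottom>\<close> amount to two relations: the even parts of \<open>P\<close> and \<open>Q\<close> add up to \<open>0\<close>, and the
  derivative of the even part of \<open>Q\<close> is \<open>\<alpha>\<close> times the odd part of \<open>P\<close> plus \<open>\<beta>\<close> times the odd part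
  of \<open>Q\<close>. For such a pair \<open>Q(x) + Q(-x)\<close> solves a first-order linear equation on the half-line
  driven by the values of \<open>P\<close> on the left and \<open>Q\<close> on the right, so these values determine the pair,
  with a bound. The relations are linear and preserved by \<open>C\<^sub>D(t)\<close>, whence
  \<open>E\<^sup>\<bottom> Cos\<^sup>\<bottom>(t) = C\<^sub>D(t) E\<^sup>\<bottom>\<close>: the family is the restriction of \<open>C\<^sub>D\<close> to an invariant closed
  subspace. Its generator is thus read off from that of \<open>C\<^sub>D\<close>, which is the second derivative.
  Finally \<open>E\<^sup>\<bottom> f\<close> has second derivative \<open>E\<^sup>\<bottom> g\<close> exactly if \<open>(f, g)\<close> is in the graph of \<open>A\<^sup>\<bottom>\<close>:
  the boundary condition is the derivative of the second relation at \<open>0\<close>, and conversely it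
  provides the initial values with which integrating \<open>E\<^sup>\<bottom> g\<close> twice yields a pair satisfying
  both relations again.
\<close>

section \<open>Cosine families\<close>

text \<open>The estimate \<open>below\<close> makes \<open>E\<close> injective and, together with
  boundedness, lets convergence be tested after applying \<open>E\<close>. Each axiom for
  \<open>U\<close>, and the limit defining its generator, thus carries over from \<open>C\<close>
  through \<open>intertwine\<close>.\<close>

lemma cosine_family_pullback:
  fixes E :: "'a::banach \<Rightarrow> 'b::banach"
  assumes C: "cosine_family C" and E: "bounded_linear E"
    and intertwine: "\<And>t f. E (U t f) = C t (E f)"
    and below: "\<And>f. norm f \<le> M * norm (E f)"
  shows "cosine_family U"
    and "cosine_generator U = {(f, g). (E f, E g) \<in> cosine_generator C}"
proof -
  interpret E: bounded_linear E by (rule E)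
  have bl: "bounded_linear (C t)" for t using C by (simp add: cosine_family_def)
  have inj: "f = g" if "E f = E g" for f g
    using below[of "f - g"] that by (simp add: E.diff)
  have tendsto: "((\<lambda>t. h t) \<longlongrightarrow> g) F \<longleftrightarrow> ((\<lambda>t. E (h t)) \<longlongrightarrow> E g) F" for h g and F :: "real filter"
  proof
    assume "((\<lambda>t. E (h t)) \<longlongrightarrow> E g) F"
    then have "((\<lambda>t. E (h t - g)) \<longlongrightarrow> 0) F" by (simp add: E.diff LIM_zero_iff)
    then have "((\<lambda>t. h t - g) \<longlongrightarrow> 0) F"
      by (rule tendsto_0_le[where K = M]) (use below in \<open>simp add: mult.commute\<close>)
    then show "(h \<longlongrightarrow> g) F" by (simp add: LIM_zero_iff)
  qed (rule E.tendsto)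
  show "cosine_family U"
    unfolding cosine_family_def
  proof (intro conjI allI)
    fix t s :: real and f
    obtain K where K: "norm (C t (E f)) \<le> norm f * K" for f
      using bounded_linear.bounded[OF bounded_linear_compose[OF bl E]] by blast
    show "bounded_linear (U t)"
    proof (rule bounded_linear_intro)
      fix f g :: 'a and r :: real
      show "U t (f + g) = U t f + U t g" "U t (r *\<^sub>R f) = r *\<^sub>R U t f"
        by (intro inj; simp add: intertwine E.add E.scaleR linear_add linear_scale
              bl[THEN bounded_linear.linear])+
      \<comment> \<open>The sign of \<open>M\<close> is not fixed, so \<open>\<bar>M\<bar>\<close>
        serves as the monotone factor.\<close>
      have "norm (U t f) \<le> \<bar>M\<bar> * norm (E (U t f))"
        using below[of "U t f"] mult_right_mono[OF abs_ge_self norm_ge_zero] by (rule order_trans)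
      also have "\<dots> \<le> \<bar>M\<bar> * (norm f * K)"
        using K[of f] by (intro mult_left_mono) (auto simp: intertwine)
      finally show "norm (U t f) \<le> norm f * (\<bar>M\<bar> * K)" by (simp add: ac_simps)
    qed
    show "continuous_on UNIV (\<lambda>t. U t f)"
      using C by (simp add: continuous_on_def tendsto[of "\<lambda>t. U t f"] intertwine cosine_family_def)
    show "U 0 f = f" using C by (intro inj) (simp add: intertwine cosine_family_def)
    show "2 *\<^sub>R U t (U s f) = U (t + s) f + U (t - s) f"
      using C by (intro inj) (simp add: E.scaleR E.add intertwine cosine_family_def)
  qed
  show "cosine_generator U = {(f, g). (E f, E g) \<in> cosine_generator C}"
    by (simp add: cosine_generator_def tendsto[of "\<lambda>t. (2 / t\<^sup>2) *\<^sub>R (U t _ - _)"]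
        E.scaleR E.diff intertwine)
qed

lemma cosine_family_prod:
  assumes "cosine_family C" "cosine_family D"
  shows "cosine_family (\<lambda>t (f, g). (C t f, D t g))"
  using assms unfolding cosine_family_def case_prod_beta
  by (auto intro!: bounded_linear_Pair bounded_linear_fst_comp bounded_linear_snd_comp
      continuous_on_Pair bounded_linear_compose[OF _ bounded_linear_fst]
      bounded_linear_compose[OF _ bounded_linear_snd] simp: prod_eq_iff)

lemma cosine_generator_prod:
  "((f, g), (f', g')) \<in> cosine_generator (\<lambda>t (f, g). (C t f, D t g)) \<longleftrightarrow>
     (f, f') \<in> cosine_generator C \<and> (g, g') \<in> cosine_generator D"
  by (auto simp: cosine_generator_def dest: tendsto_fst tendsto_snd intro: tendsto_Pair)

section \<open>Symmetric second differences\<close>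

text \<open>Prescribing the value at \<open>a\<close> allows initial data to be imposed when a
  function is integrated twice.\<close>

lemma ex_antiderivative:
  fixes f :: "real \<Rightarrow> real"
  assumes "continuous_on UNIV f"
  shows "\<exists>F. F a = b \<and> (\<forall>x. (F has_real_derivative f x) (at x))"
proof -
  obtain F where F: "\<And>x. (F has_real_derivative f x) (at x)"
    using einterval_antiderivative[of "-\<infinity>" "\<infinity>" f] assms
    by (auto simp: continuous_on_eq_continuous_at has_real_derivative_iff_has_vector_derivative)
  show ?thesis
    by (rule exI[of _ "\<lambda>x. F x - F a + b"]) (auto intro!: derivative_eq_intros F)
qed

text \<open>Subtracting an antiderivative of \<open>g\<close> leaves a continuous function with zero
  derivative off \<open>a\<close>, hence a constant. This handles the point 0, where the formulas
  for the extensions change.\<close>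

lemma has_real_derivative_at_exceptional_point:
  fixes f g :: "real \<Rightarrow> real"
  assumes f: "continuous_on UNIV f" and g: "continuous_on UNIV g"
    and d: "\<And>x. x \<noteq> a \<Longrightarrow> (f has_real_derivative g x) (at x)"
  shows "(f has_real_derivative g x) (at x)"
proof -
  obtain G where G: "\<And>x. (G has_real_derivative g x) (at x)" using ex_antiderivative[OF g] by blast
  then have cG: "continuous_on UNIV G" by (meson DERIV_isCont continuous_at_imp_continuous_on)
  have "f y - G y = f a - G a" for y
  proof -
    show ?thesis
    proof (rule has_derivative_zero_unique_strong_convex[of UNIV "{a}" "\<lambda>y. f y - G y" a])
      show "continuous_on UNIV (\<lambda>y. f y - G y)" by (intro continuous_intros f cG)
      fix y assume "y \<in> UNIV - {a}"
      then have "((\<lambda>y. f y - G y) has_real_derivative 0) (at y)"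
        by (auto intro!: derivative_eq_intros d G)
      then show "((\<lambda>y. f y - G y) has_derivative (\<lambda>h. 0)) (at y within UNIV)"
        by (simp add: has_field_derivative_def flip: lambda_zero)
    qed auto
  qed
  then obtain c where c: "f = (\<lambda>y. G y + c)" by (metis diff_eq_eq add.commute ext)
  show ?thesis unfolding c by (auto intro!: derivative_eq_intros G)
qed

text \<open>Schwarz's argument: if \<open>H\<close> were positive somewhere, adding a small convex
  parabola vanishing at \<open>p\<close> and \<open>q\<close> would leave a positive interior
  maximum. There the symmetric second difference is nonpositive, whereas the parabola forces its
  limit to be \<open>2 * e > 0\<close>.\<close>

lemma symmetric_difference_zero_imp_le_chord:
  fixes H :: "real \<Rightarrow> real"
  assumes cont: "continuous_on UNIV H"
    and lim: "\<And>x. ((\<lambda>t. (H (x + t) + H (x - t) - 2 * H x) / t\<^sup>2) \<longlongrightarrow> 0) (at 0)"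
    and ends: "H p = 0" "H q = 0" and c: "p \<le> c" "c \<le> q"
  shows "H c \<le> 0"
proof (rule ccontr)
  assume "\<not> H c \<le> 0"
  then have pos: "H c > 0" by simp
  then have pq: "p < c" "c < q" using ends c by (auto simp: less_le)
  \<comment> \<open>With this choice the parabola equals \<open>- H c / 2\<close> at
    \<open>c\<close>, so \<open>h c\<close> is still half of \<open>H c\<close>.\<close>
  define e where "e = H c / (2 * ((c - p) * (q - c)))"
  have e: "e > 0" using pos pq by (simp add: e_def)
  define h where "h x = H x + e * ((x - p) * (x - q))" for x
  have "(c - p) * (q - c) \<noteq> 0" using pq by simp
  then have "e * ((c - p) * (q - c)) = H c / 2" by (simp add: e_def)
  then have hc: "h c > 0" using pos by (simp add: h_def algebra_simps)
  have "continuous_on {p..q} h" unfolding h_def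
    by (intro continuous_intros continuous_on_subset[OF cont]) auto
  then obtain m where m: "m \<in> {p..q}" "\<And>y. y \<in> {p..q} \<Longrightarrow> h y \<le> h m"
    using continuous_attains_sup[of "{p..q}" h] c by auto
  have "h m > 0" using m(2)[of c] hc c by simp
  \<comment> \<open>\<open>h\<close> vanishes at both ends, so a point with a positive value is
    interior.\<close>
  then have mpq: "p < m" "m < q" using m(1) ends by (auto simp: h_def less_le)
  have "((\<lambda>t. (H (m + t) + H (m - t) - 2 * H m) / t\<^sup>2 + 2 * e) \<longlongrightarrow> 0 + 2 * e) (at 0)"
    by (intro tendsto_intros lim)
  moreover have "\<forall>\<^sub>F t in at 0. (H (m + t) + H (m - t) - 2 * H m) / t\<^sup>2 + 2 * e \<le> 0"
    unfolding eventually_at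
  proof (intro exI conjI ballI impI)
    show "min (m - p) (q - m) > 0" using mpq by simp
    fix t :: real assume t: "t \<noteq> 0 \<and> dist t 0 < min (m - p) (q - m)"
    then have "h (m + t) \<le> h m" "h (m - t) \<le> h m" by (auto intro!: m)
    then have "H (m + t) + H (m - t) - 2 * H m + 2 * e * t\<^sup>2 \<le> 0"
      by (simp add: h_def algebra_simps power2_eq_square)
    moreover have "(H (m + t) + H (m - t) - 2 * H m) / t\<^sup>2 + 2 * e
        = (H (m + t) + H (m - t) - 2 * H m + 2 * e * t\<^sup>2) / t\<^sup>2"
      using t by (simp add: field_simps)
    ultimately show "(H (m + t) + H (m - t) - 2 * H m) / t\<^sup>2 + 2 * e \<le> 0"
      by (simp add: divide_nonpos_nonneg)
  qed
  ultimately have "0 + 2 * e \<le> 0" by (intro tendsto_upperbound) auto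
  then show False using e by simp
qed

text \<open>The previous bound, applied to \<open>H\<close> minus its chord and to the chord minus
  \<open>H\<close>, shows that \<open>H\<close> equals its chord on every interval.\<close>

lemma symmetric_difference_zero_imp_affine:
  fixes H :: "real \<Rightarrow> real"
  assumes cont: "continuous_on UNIV H"
    and lim: "\<And>x. ((\<lambda>t. (H (x + t) + H (x - t) - 2 * H x) / t\<^sup>2) \<longlongrightarrow> 0) (at 0)"
  shows "H x = H 0 + (H 1 - H 0) * x"
proof -
  have chord: "H c = H p + (H q - H p) / (q - p) * (c - p)" if c: "p \<le> c" "c \<le> q" "p < q" for p c q
  proof -
    define a where "a = (H q - H p) / (q - p)"
    have a: "a * (q - p) = H q - H p" using c by (simp add: a_def)
    have "H c - H p - a * (c - p) \<le> 0"
      by (rule symmetric_difference_zero_imp_le_chord[of "\<lambda>x. H x - H p - a * (x - p)" p q])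
         (use lim c a in \<open>auto intro!: continuous_intros cont simp: algebra_simps\<close>)
    moreover have "H p + a * (c - p) - H c \<le> 0"
    proof (rule symmetric_difference_zero_imp_le_chord[of "\<lambda>x. H p + a * (x - p) - H x" p q])
      fix x
      show "((\<lambda>t. (H p + a * (x + t - p) - H (x + t) + (H p + a * (x - t - p) - H (x - t)) -
              2 * (H p + a * (x - p) - H x)) / t\<^sup>2) \<longlongrightarrow> 0) (at 0)"
        using tendsto_minus[OF lim[of x], unfolded minus_zero]
        unfolding minus_divide_left
        by (rule Lim_transform_eventually)
           (intro always_eventually allI arg_cong2[of _ _ _ _ "(/)"] refl, simp add: algebra_simps)
    qed (use c a in \<open>auto intro!: continuous_intros cont simp: algebra_simps\<close>)
    ultimately show ?thesis by (simp add: a_def)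
  qed
  \<comment> \<open>One interval containing \<open>x\<close>, 0 and 1 puts all three values on the
    same chord.\<close>
  define p where "p = min x 0" define q where "q = max x 1"
  define a where "a = (H q - H p) / (q - p)"
  have "H y = H p + a * (y - p)" if "y \<in> {x, 0, 1}" for y
    unfolding a_def by (rule chord) (use that in \<open>auto simp: p_def q_def\<close>)
  then have "H x = H p + a * (x - p)" "H 0 = H p + a * (0 - p)" "H 1 = H p + a * (1 - p)"
    by blast+
  then have "H 1 - H 0 = a" "H x = H 0 + a * x" by (simp_all add: algebra_simps)
  then show ?thesis by simp
qed

text \<open>The function sending \<open>s\<close> to \<open>F (x + s) + F (x - s)\<close> is even,
  so its Taylor expansion at 0 has no linear term and the quotient is exactly the second-order
  remainder. The modulus of continuity of \<open>F2\<close> then controls the error.\<close>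

lemma Maclaurin_symmetric_difference:
  fixes F :: "real \<Rightarrow> real"
  assumes F: "\<And>x. (F has_real_derivative F1 x) (at x)" "\<And>x. (F1 has_real_derivative F2 x) (at x)"
    and t: "t \<noteq> 0"
  shows "\<exists>s. 0 < s \<and> s < \<bar>t\<bar> \<and> (F (x + t) + F (x - t) - 2 * F x) / t\<^sup>2 = (F2 (x + s) + F2 (x - s)) / 2"
proof -
  \<comment> \<open>\<open>d m\<close> is the \<open>m\<close>-th derivative of the even function,
    in the indexed form that \<open>Maclaurin\<close> expects.\<close>
  define d where "d m s = (if m = 0 then F (x + s) + F (x - s)
    else if m = (1::nat) then F1 (x + s) - F1 (x - s) else F2 (x + s) + F2 (x - s))" for m s
  have "\<exists>s>0. s < \<bar>t\<bar> \<and> d 0 \<bar>t\<bar> = (\<Sum>m<2. d m 0 / fact m * \<bar>t\<bar> ^ m) + d 2 s / fact 2 * \<bar>t\<bar> ^ 2"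
  proof (rule Maclaurin)
    show "\<forall>m s. m < 2 \<and> 0 \<le> s \<and> s \<le> \<bar>t\<bar> \<longrightarrow> (d m has_real_derivative d (Suc m) s) (at s)"
    proof (intro allI impI)
      fix m :: nat and s :: real assume m: "m < 2 \<and> 0 \<le> s \<and> s \<le> \<bar>t\<bar>"
      have 1: "((\<lambda>s. h (x + s)) has_real_derivative h' (x + s)) (at s)"
        "((\<lambda>s. h (x - s)) has_real_derivative - h' (x - s)) (at s)"
        if "\<And>x. (h has_real_derivative h' x) (at x)" for h h' :: "real \<Rightarrow> real"
      proof -
        have "((+) x has_real_derivative 1) (at s)" "((-) x has_real_derivative - 1) (at s)"
          by (auto intro!: derivative_eq_intros)
        then show "((\<lambda>s. h (x + s)) has_real_derivative h' (x + s)) (at s)"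
          "((\<lambda>s. h (x - s)) has_real_derivative - h' (x - s)) (at s)"
          using DERIV_chain2[where f = h and g = "(+) x", OF that, of 1 s]
            DERIV_chain2[where f = h and g = "(-) x", OF that, of "- 1" s] by simp_all
      qed
      consider "m = 0" | "m = 1" using m by linarith
      then show "(d m has_real_derivative d (Suc m) s) (at s)"
        by cases (auto simp: d_def[abs_def] intro!: derivative_eq_intros 1 F)
    qed
  qed (use t in auto)
  then obtain s where s: "0 < s" "s < \<bar>t\<bar>"
    "F (x + \<bar>t\<bar>) + F (x - \<bar>t\<bar>) = 2 * F x + (F2 (x + s) + F2 (x - s)) / 2 * t\<^sup>2"
    by (auto simp: d_def lessThan_nat_numeral numeral_2_eq_2 power2_eq_square)
  moreover have "F (x + \<bar>t\<bar>) + F (x - \<bar>t\<bar>) = F (x + t) + F (x - t)" by (cases "t \<ge> 0") auto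
  ultimately show ?thesis using t by (intro exI[of _ s]) (simp add: field_simps)
qed

section \<open>The basic cosine family\<close>

text \<open>Near either infinity the values are close to a limit, and the middle is compact.
  Uniformity in \<open>x\<close> is what later turns pointwise estimates into sup-norm
  estimates.\<close>

lemma cinf_set_uniformly_continuous:
  assumes f: "f \<in> cinf_set"
  shows "uniformly_continuous_on UNIV f"
  unfolding uniformly_continuous_on_def
proof (intro allI impI)
  fix e :: real assume e: "e > 0"
  from f obtain l m where c: "continuous_on UNIV f"
    and l: "(f \<longlongrightarrow> l) at_top" and m: "(f \<longlongrightarrow> m) at_bot"
    by (auto simp: cinf_set_def)
  have "eventually (\<lambda>x. dist (f x) l < e/2) at_top" using l by (rule tendstoD) (use e in simp)
  then obtain b where b: "\<And>x. x \<ge> b \<Longrightarrow> dist (f x) l < e/2"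
    by (auto simp: eventually_at_top_linorder)
  have "eventually (\<lambda>x. dist (f x) m < e/2) at_bot" using m by (rule tendstoD) (use e in simp)
  then obtain a where a: "\<And>x. x \<le> a \<Longrightarrow> dist (f x) m < e/2"
    by (auto simp: eventually_at_bot_linorder)
  have "uniformly_continuous_on {a - 1..b + 1} f"
    by (intro compact_uniformly_continuous continuous_on_subset[OF c]) auto
  then obtain d where d: "d > 0"
    "\<And>x y. x \<in> {a - 1..b + 1} \<Longrightarrow> y \<in> {a - 1..b + 1} \<Longrightarrow> dist y x < d \<Longrightarrow> dist (f y) (f x) < e"
    using e unfolding uniformly_continuous_on_def by metis
  have "dist (f y) (f x) < e" if xy: "dist y x < min d 1" for x y
  proof -
    \<comment> \<open>The compact interval overlaps both tails by 1, so two points less than 1 apart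
      always share a region.\<close>
    consider "x \<le> a" "y \<le> a" | "x \<ge> b" "y \<ge> b" | "x \<in> {a - 1..b + 1}" "y \<in> {a - 1..b + 1}"
      using xy by (fastforce simp: dist_real_def)
    then show ?thesis
    proof cases
      case 1 then show ?thesis using a[of x] a[of y] dist_triangle_half_l by blast
    next
      case 2 then show ?thesis using b[of x] b[of y] dist_triangle_half_l by blast
    next
      case 3 then show ?thesis using xy by (intro d) auto
    qed
  qed
  then show "\<exists>d>0. \<forall>x\<in>UNIV. \<forall>x'\<in>UNIV. dist x' x < d \<longrightarrow> dist (f x') (f x) < e"
    using d(1) by (intro exI[of _ "min d 1"]) auto
qed

lemma norm_cinf_le:
  assumes "\<And>x. \<bar>apply_cinf f x\<bar> \<le> B"
  shows "norm f \<le> B"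
  unfolding norm_cinf.rep_eq by (intro cSUP_least assms) simp

lemma cosine_family_basic: "cosine_family basic_cosine"
  unfolding cosine_family_def
proof (intro conjI allI)
  fix t s :: real and f :: cinf
  show "bounded_linear (basic_cosine t)"
  proof (rule bounded_linear_intro[where K = 1])
    fix f g :: cinf and r :: real
    show "basic_cosine t (f + g) = basic_cosine t f + basic_cosine t g"
      by transfer (auto simp: field_simps)
    show "basic_cosine t (r *\<^sub>R f) = r *\<^sub>R basic_cosine t f"
      by transfer (auto simp: field_simps)
    have "\<bar>apply_cinf (basic_cosine t f) x\<bar> \<le> norm f" for x
      using norm_cinf_upper[of f "x + t"] norm_cinf_upper[of f "x - t"]
      by (simp add: basic_cosine.rep_eq)
    then show "norm (basic_cosine t f) \<le> norm f * 1" by (simp add: norm_cinf_le)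
  qed
  show "basic_cosine 0 f = f" by transfer auto
  show "2 *\<^sub>R basic_cosine t (basic_cosine s f) = basic_cosine (t + s) f + basic_cosine (t - s) f"
    by (rule cinf_eqI) (simp add: basic_cosine.rep_eq plus_cinf.rep_eq scaleR_cinf.rep_eq
        algebra_simps)
  show "continuous_on UNIV (\<lambda>t. basic_cosine t f)"
    unfolding continuous_on_iff
  proof (intro ballI allI impI)
    fix t e :: real assume e: "e > 0"
    obtain d where d: "d > 0"
      "\<And>x y. dist y x < d \<Longrightarrow> dist (apply_cinf f y) (apply_cinf f x) < e / 2"
      using cinf_set_uniformly_continuous[OF apply_cinf, of f] half_gt_zero[OF e]
      unfolding uniformly_continuous_on_def by (metis UNIV_I)
    have "dist (basic_cosine s f) (basic_cosine t f) < e" if st: "dist s t < d" for s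
    proof -
      \<comment> \<open>The supremum only preserves the weak inequality; the bound
        \<open>e / 2\<close> leaves room for a strict one.\<close>
      have "\<bar>apply_cinf (basic_cosine s f - basic_cosine t f) x\<bar> \<le> e / 2" for x
        using d(2)[of "x + s" "x + t"] d(2)[of "x - s" "x - t"] st
        unfolding minus_cinf.rep_eq basic_cosine.rep_eq dist_real_def by (simp, argo)
      then have "norm (basic_cosine s f - basic_cosine t f) \<le> e / 2" by (rule norm_cinf_le)
      then show ?thesis using e by (simp add: dist_norm)
    qed
    then show "\<exists>d>0. \<forall>s\<in>UNIV. dist s t < d \<longrightarrow> dist (basic_cosine s f) (basic_cosine t f) < e"
      using d(1) by blast
  qed
qed

lemma apply_second_difference:
  "apply_cinf ((2 / t\<^sup>2) *\<^sub>R (basic_cosine t f - f)) x =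
     (apply_cinf f (x + t) + apply_cinf f (x - t) - 2 * apply_cinf f x) / t\<^sup>2"
  by (simp add: scaleR_cinf.rep_eq minus_cinf.rep_eq basic_cosine.rep_eq add_divide_distrib
      diff_divide_distrib right_diff_distrib)

text \<open>Membership in the generator only yields convergent symmetric differences, not
  differentiability. Comparing \<open>f\<close> with a twofold antiderivative of \<open>g\<close>
  supplies it: the two differ by an affine function. Conversely,
  \<open>Maclaurin_symmetric_difference\<close> and uniform continuity of \<open>g\<close> give
  convergence in norm.\<close>

lemma cosine_generator_basic:
  "(f, g) \<in> cosine_generator basic_cosine \<longleftrightarrow>
     (\<exists>f1. \<forall>x. (apply_cinf f has_real_derivative f1 x) (at x) \<and>
       (f1 has_real_derivative apply_cinf g x) (at x))"
proof
  assume "(f, g) \<in> cosine_generator basic_cosine"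
  then have *: "((\<lambda>t. (2 / t\<^sup>2) *\<^sub>R (basic_cosine t f - f)) \<longlongrightarrow> g) (at 0)"
    by (simp add: cosine_generator_def)
  let ?f = "apply_cinf f" and ?g = "apply_cinf g"
  have lim_f: "((\<lambda>t. (?f (x + t) + ?f (x - t) - 2 * ?f x) / t\<^sup>2) \<longlongrightarrow> ?g x) (at 0)" for x
  proof -
    have "((\<lambda>t. norm ((2 / t\<^sup>2) *\<^sub>R (basic_cosine t f - f) - g)) \<longlongrightarrow> 0) (at 0)"
      using * by (simp add: LIM_zero_iff tendsto_norm_zero_iff)
    then have "((\<lambda>t. apply_cinf ((2 / t\<^sup>2) *\<^sub>R (basic_cosine t f - f) - g) x) \<longlongrightarrow> 0) (at 0)"
      by (rule tendsto_0_le[where K = 1]) (auto intro!: always_eventually order_trans[OF norm_cinf_upper])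
    then show ?thesis by (simp add: minus_cinf.rep_eq apply_second_difference LIM_zero_iff)
  qed
  have cf: "continuous_on UNIV ?f" and cg: "continuous_on UNIV ?g"
    using apply_cinf[of f] apply_cinf[of g] by (auto simp: cinf_set_def)
  obtain G1 where G1: "\<And>x. (G1 has_real_derivative ?g x) (at x)"
    using ex_antiderivative[OF cg] by blast
  then have "continuous_on UNIV G1" by (meson DERIV_isCont continuous_at_imp_continuous_on)
  then obtain G where G: "\<And>x. (G has_real_derivative G1 x) (at x)"
    using ex_antiderivative by blast
  then have cG: "continuous_on UNIV G" by (meson DERIV_isCont continuous_at_imp_continuous_on)
  have lim_G: "((\<lambda>t. (G (x + t) + G (x - t) - 2 * G x) / t\<^sup>2) \<longlongrightarrow> ?g x) (at 0)" for x
  proof (rule LIM_I)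
    fix r :: real assume "r > 0"
    moreover have "isCont ?g x" using cg by (simp add: continuous_on_eq_continuous_at)
    ultimately obtain d where d: "d > 0" "\<And>y. dist y x < d \<Longrightarrow> dist (?g y) (?g x) < r"
      unfolding continuous_at_eps_delta by blast
    have "norm ((G (x + t) + G (x - t) - 2 * G x) / t\<^sup>2 - ?g x) < r" if t: "t \<noteq> 0 \<and> norm (t - 0) < d" for t
    proof -
      obtain s where s: "0 < s" "s < \<bar>t\<bar>"
        "(G (x + t) + G (x - t) - 2 * G x) / t\<^sup>2 = (?g (x + s) + ?g (x - s)) / 2"
        using Maclaurin_symmetric_difference[of G G1 ?g t x] G G1 t by blast
      show ?thesis using d(2)[of "x + s"] d(2)[of "x - s"] s(1,2) t
        unfolding s(3) dist_real_def by (simp, argo)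
    qed
    then show "\<exists>s>0. \<forall>t. t \<noteq> 0 \<and> norm (t - 0) < s \<longrightarrow>
        norm ((G (x + t) + G (x - t) - 2 * G x) / t\<^sup>2 - ?g x) < r"
      using d(1) by blast
  qed
  \<comment> \<open>The symmetric second differences of both terms have the same limit, so those of
    \<open>H\<close> tend to 0.\<close>
  define H where "H x = ?f x - G x" for x
  have "H x = H 0 + (H 1 - H 0) * x" for x
  proof (rule symmetric_difference_zero_imp_affine)
    show "continuous_on UNIV H" unfolding H_def by (intro continuous_intros cf cG)
    show "((\<lambda>t. (H (x + t) + H (x - t) - 2 * H x) / t\<^sup>2) \<longlongrightarrow> 0) (at 0)" for x
      using tendsto_diff[OF lim_f[of x] lim_G[of x]]
      by (simp add: H_def algebra_simps flip: diff_divide_distrib add_divide_distrib)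
  qed
  then have "?f = (\<lambda>x. G x + (H 0 + (H 1 - H 0) * x))"
    by (intro ext) (metis H_def add.commute diff_add_cancel)
  moreover have "((\<lambda>x. G x + (H 0 + (H 1 - H 0) * x)) has_real_derivative G1 x + (H 1 - H 0)) (at x)" for x
    by (auto intro!: derivative_eq_intros G)
  moreover have "((\<lambda>x. G1 x + (H 1 - H 0)) has_real_derivative ?g x) (at x)" for x
    by (auto intro!: derivative_eq_intros G1)
  ultimately show "\<exists>f1. \<forall>x. (?f has_real_derivative f1 x) (at x) \<and> (f1 has_real_derivative ?g x) (at x)"
    by (intro exI[of _ "\<lambda>x. G1 x + (H 1 - H 0)"]) simp
next
  let ?f = "apply_cinf f" and ?g = "apply_cinf g"
  assume "\<exists>f1. \<forall>x. (?f has_real_derivative f1 x) (at x) \<and> (f1 has_real_derivative ?g x) (at x)"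
  then obtain f1 where f1: "\<And>x. (?f has_real_derivative f1 x) (at x)"
    "\<And>x. (f1 has_real_derivative ?g x) (at x)" by blast
  have "((\<lambda>t. (2 / t\<^sup>2) *\<^sub>R (basic_cosine t f - f)) \<longlongrightarrow> g) (at 0)"
  proof (rule LIM_I)
    fix r :: real assume r: "r > 0"
    obtain d where d: "d > 0" "\<And>x y. dist y x < d \<Longrightarrow> dist (?g y) (?g x) < r / 2"
      using cinf_set_uniformly_continuous[OF apply_cinf, of g] half_gt_zero[OF r]
      unfolding uniformly_continuous_on_def by (metis UNIV_I)
    have "norm ((2 / t\<^sup>2) *\<^sub>R (basic_cosine t f - f) - g) < r" if t: "t \<noteq> 0 \<and> norm (t - 0) < d" for t
    proof -
      have "\<bar>apply_cinf ((2 / t\<^sup>2) *\<^sub>R (basic_cosine t f - f) - g) x\<bar> \<le> r / 2" for x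
      proof -
        obtain s where s: "0 < s" "s < \<bar>t\<bar>"
          "(?f (x + t) + ?f (x - t) - 2 * ?f x) / t\<^sup>2 = (?g (x + s) + ?g (x - s)) / 2"
          using Maclaurin_symmetric_difference[of ?f f1 ?g t x] f1 t by blast
        show ?thesis using d(2)[of "x + s" x] d(2)[of "x - s" x] s(1,2) t
          unfolding minus_cinf.rep_eq apply_second_difference s(3) dist_real_def by (simp, argo)
      qed
      then have "norm ((2 / t\<^sup>2) *\<^sub>R (basic_cosine t f - f) - g) \<le> r / 2" by (rule norm_cinf_le)
      then show ?thesis using r by simp
    qed
    then show "\<exists>s>0. \<forall>t. t \<noteq> 0 \<and> norm (t - 0) < s \<longrightarrow>
        norm ((2 / t\<^sup>2) *\<^sub>R (basic_cosine t f - f) - g) < r" using d(1) by blast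
  qed
  then show "(f, g) \<in> cosine_generator basic_cosine" by (simp add: cosine_generator_def)
qed

section \<open>The range of the extension operator\<close>

text \<open>The sums and differences are twice the even and odd parts, so the factors cancel in the
  second relation. Imposing the relations on the whole line, not just for positive arguments, makes
  them accessible at every shifted point.\<close>

definition matching_pair :: "real \<Rightarrow> real \<Rightarrow> (real \<Rightarrow> real) \<Rightarrow> (real \<Rightarrow> real) \<Rightarrow> bool" where
  "matching_pair \<alpha> \<beta> P Q \<longleftrightarrow>
     (\<forall>x. P x + P (- x) + Q x + Q (- x) = 0) \<and>
     (\<forall>x. ((\<lambda>x. Q x + Q (- x)) has_real_derivative
        \<alpha> * (P x - P (- x)) + \<beta> * (Q x - Q (- x))) (at x))"

section \<open>Linear operations, translation and uniqueness for matching pairs\<close>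

lemma matching_pair_add:
  assumes "matching_pair \<alpha> \<beta> P Q" "matching_pair \<alpha> \<beta> P' Q'"
  shows "matching_pair \<alpha> \<beta> (\<lambda>x. P x + P' x) (\<lambda>x. Q x + Q' x)"
  unfolding matching_pair_def
proof (intro conjI allI)
  fix x
  have "P x + P (- x) + Q x + Q (- x) = 0" "P' x + P' (- x) + Q' x + Q' (- x) = 0"
    using assms by (simp_all add: matching_pair_def)
  then show "P x + P' x + (P (- x) + P' (- x)) + (Q x + Q' x) + (Q (- x) + Q' (- x)) = 0"
    by linarith
  have "((\<lambda>x. (Q x + Q (- x)) + (Q' x + Q' (- x))) has_real_derivative
      (\<alpha> * (P x - P (- x)) + \<beta> * (Q x - Q (- x))) + (\<alpha> * (P' x - P' (- x)) + \<beta> * (Q' x - Q' (- x)))) (at x)"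
    using assms by (intro DERIV_add[of "\<lambda>x. Q x + Q (- x)" _ _ _ "\<lambda>x. Q' x + Q' (- x)"])
       (simp_all add: matching_pair_def)
  then show "((\<lambda>x. Q x + Q' x + (Q (- x) + Q' (- x))) has_real_derivative
      \<alpha> * (P x + P' x - (P (- x) + P' (- x))) + \<beta> * (Q x + Q' x - (Q (- x) + Q' (- x)))) (at x)"
    by (simp add: algebra_simps)
qed

lemma matching_pair_scale:
  assumes "matching_pair \<alpha> \<beta> P Q"
  shows "matching_pair \<alpha> \<beta> (\<lambda>x. r * P x) (\<lambda>x. r * Q x)"
  unfolding matching_pair_def
proof (intro conjI allI)
  fix x
  have "r * (P x + P (- x) + Q x + Q (- x)) = 0"
    using assms by (simp add: matching_pair_def)
  then show "r * P x + r * P (- x) + r * Q x + r * Q (- x) = 0"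
    by (simp add: algebra_simps)
  have "((\<lambda>x. r * (Q x + Q (- x))) has_real_derivative
      r * (\<alpha> * (P x - P (- x)) + \<beta> * (Q x - Q (- x)))) (at x)"
    using assms unfolding matching_pair_def by (intro DERIV_cmult) auto
  then show "((\<lambda>x. r * Q x + r * Q (- x)) has_real_derivative
      \<alpha> * (r * P x - r * P (- x)) + \<beta> * (r * Q x - r * Q (- x))) (at x)"
    by (simp add: algebra_simps)
qed

text \<open>Reflection sends \<open>x + t\<close> to \<open>- x - t\<close>, which belongs to the
  other shift. Hence the two shifts are taken together: the relations at \<open>x\<close> are the
  sums of the original ones at \<open>x + t\<close> and \<open>x - t\<close>.\<close>

lemma matching_pair_translates:
  assumes "matching_pair \<alpha> \<beta> P Q"
  shows "matching_pair \<alpha> \<beta> (\<lambda>x. P (x + t) + P (x - t)) (\<lambda>x. Q (x + t) + Q (x - t))"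
  unfolding matching_pair_def
proof (intro conjI allI)
  fix x
  have neg: "- (y + t) = - y - t" "- (y - t) = - y + t" "- t - y = - y - t" for y
    by simp_all
  have z: "P y + P (- y) + Q y + Q (- y) = 0" for y using assms by (simp add: matching_pair_def)
  have d: "((\<lambda>y. Q y + Q (- y)) has_real_derivative
      \<alpha> * (P y - P (- y)) + \<beta> * (Q y - Q (- y))) (at y)" for y
    using assms by (simp add: matching_pair_def)
  show "P (x + t) + P (x - t) + (P (- x + t) + P (- x - t)) + (Q (x + t) + Q (x - t)) +
      (Q (- x + t) + Q (- x - t)) = 0"
    using z[of "x + t"] z[of "x - t"] neg by argo
  show "((\<lambda>x. Q (x + t) + Q (x - t) + (Q (- x + t) + Q (- x - t))) has_real_derivative
      \<alpha> * (P (x + t) + P (x - t) - (P (- x + t) + P (- x - t))) +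
      \<beta> * (Q (x + t) + Q (x - t) - (Q (- x + t) + Q (- x - t)))) (at x)"
    using DERIV_add[OF d[of "x + t", unfolded DERIV_shift] d[of "x + - t", unfolded DERIV_shift]]
    by (simp add: neg algebra_simps)
qed

text \<open>Eliminating \<open>P x\<close> by the first relation shows that
  \<open>s x = Q x + Q (- x)\<close> satisfies \<open>s' = - (\<alpha> + \<beta>) * s + 2 * (\<beta>
  * Q x - \<alpha> * P (- x))\<close>. For \<open>x \<ge> 0\<close> the forcing is at most
  \<open>2 * (\<alpha> + \<beta>) * N\<close>, so
  \<open>exp ((\<alpha> + \<beta>) * x) * (s x - 2 * N)\<close> is nonincreasing and starts
  nonpositive.\<close>

lemma matching_pair_upper:
  assumes Y: "matching_pair \<alpha> \<beta> P Q" and ab: "\<alpha> \<ge> 0" "\<beta> \<ge> 0"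
    and P: "\<And>x. x \<le> 0 \<Longrightarrow> \<bar>P x\<bar> \<le> N" and Q: "\<And>x. x \<ge> 0 \<Longrightarrow> \<bar>Q x\<bar> \<le> N" and x: "x \<ge> 0"
  shows "Q x + Q (- x) \<le> 2 * N"
proof -
  let ?c = "\<alpha> + \<beta>" and ?s = "\<lambda>x. Q x + Q (- x)"
  have z: "P y + P (- y) + Q y + Q (- y) = 0" for y using Y by (simp add: matching_pair_def)
  have d: "(?s has_real_derivative \<alpha> * (P y - P (- y)) + \<beta> * (Q y - Q (- y))) (at y)" for y
    using Y by (simp add: matching_pair_def)
  have "exp (?c * x) * (?s x - 2 * N) \<le> exp (?c * 0) * (?s 0 - 2 * N)"
  proof (rule DERIV_nonpos_imp_nonincreasing[OF x])
    fix y :: real assume y: "0 \<le> y" "y \<le> x"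
    let ?d = "\<alpha> * (P y - P (- y)) + \<beta> * (Q y - Q (- y)) + ?c * (?s y - 2 * N)"
    have "((\<lambda>x. exp (?c * x) * (?s x - 2 * N)) has_real_derivative exp (?c * y) * ?d) (at y)"
      by (rule derivative_eq_intros d refl | simp add: algebra_simps)+
    moreover have "?d \<le> 0"
    proof -
      have Py: "P y = - P (- y) - ?s y" using z[of y] by simp
      have "?d = 2 * (\<beta> * (Q y - N) + \<alpha> * (- P (- y) - N))"
        unfolding Py by (simp add: algebra_simps)
      also have "\<dots> \<le> 2 * (0 + 0)"
        using ab Q[of y] P[of "- y"] y
        by (intro mult_left_mono add_mono mult_nonneg_nonpos) auto
      finally show ?thesis by simp
    qed
    ultimately show "\<exists>d. ((\<lambda>x. exp (?c * x) * (?s x - 2 * N)) has_real_derivative d) (at y) \<and> d \<le> 0"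
      by (meson exp_ge_zero mult_nonneg_nonpos)
  qed
  also have "\<dots> \<le> 0" using Q[of 0] by simp
  finally show ?thesis by (simp add: mult_le_0_iff)
qed

text \<open>Applying the upper bound also to \<open>(-P, -Q)\<close> bounds
  \<open>\<bar>Q x + Q (- x)\<bar>\<close> by \<open>2 * N\<close>. The values on the other
  half-lines differ from it, up to sign, by a value bounded by \<open>N\<close>, whence the constant
  3.\<close>

lemma matching_pair_bound:
  assumes Y: "matching_pair \<alpha> \<beta> P Q" and ab: "\<alpha> \<ge> 0" "\<beta> \<ge> 0"
    and P: "\<And>x. x \<le> 0 \<Longrightarrow> \<bar>P x\<bar> \<le> N" and Q: "\<And>x. x \<ge> 0 \<Longrightarrow> \<bar>Q x\<bar> \<le> N"
  shows "\<bar>P x\<bar> \<le> 3 * N" "\<bar>Q x\<bar> \<le> 3 * N"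
proof -
  have N: "N \<ge> 0" using P[of 0] by simp
  have z: "P y + P (- y) + Q y + Q (- y) = 0" for y using Y by (simp add: matching_pair_def)
  have u: "Q y + Q (- y) \<le> 2 * N" if "y \<ge> 0" for y
    by (rule matching_pair_upper[OF Y ab P Q that])
  have l: "- 2 * N \<le> Q y + Q (- y)" if "y \<ge> 0" for y
    using matching_pair_upper[OF matching_pair_scale[OF Y, of "- 1"] ab _ _ that, of N] P Q by simp
  show "\<bar>P x\<bar> \<le> 3 * N"
  proof (cases "x \<le> 0")
    case False
    then show ?thesis using u[of x] l[of x] P[of "- x"] z[of x] by simp
  qed (use P[of x] N in simp)
  show "\<bar>Q x\<bar> \<le> 3 * N"
  proof (cases "x \<ge> 0")
    case False
    then show ?thesis using u[of "- x"] l[of "- x"] Q[of "- x"] by simp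
  qed (use Q[of x] N in simp)
qed

text \<open>The difference is again a matching pair, and the bound with \<open>N = 0\<close> makes
  it vanish.\<close>

lemma matching_pair_unique:
  assumes "matching_pair \<alpha> \<beta> P Q" "matching_pair \<alpha> \<beta> P' Q'" "\<alpha> \<ge> 0" "\<beta> \<ge> 0"
    and "\<And>x. x \<le> 0 \<Longrightarrow> P x = P' x" "\<And>x. x \<ge> 0 \<Longrightarrow> Q x = Q' x"
  shows "P = P'" "Q = Q'"
proof -
  have Y: "matching_pair \<alpha> \<beta> (\<lambda>x. P x + - 1 * P' x) (\<lambda>x. Q x + - 1 * Q' x)"
    by (intro matching_pair_add matching_pair_scale assms)
  have "\<bar>P x + - 1 * P' x\<bar> \<le> 3 * 0" "\<bar>Q x + - 1 * Q' x\<bar> \<le> 3 * 0" for x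
    by (rule matching_pair_bound[OF Y]; use assms in simp)+
  then show "P = P'" "Q = Q'" by (auto simp: fun_eq_iff)
qed

section \<open>The extension operator produces matching pairs\<close>

lemma has_real_derivative_E_int:
  assumes x: "x > 0"
  shows "(E_int \<alpha> \<beta> f has_real_derivative
    \<beta> * apply_cov f x - \<alpha> * apply_cov f (- x) - (\<alpha> + \<beta>) * E_int \<alpha> \<beta> f x) (at x)"
proof -
  let ?c = "\<alpha> + \<beta>"
  define g where "g y = exp (?c * y) *
    (\<beta> * right_part (csharp_of_cov f) y - \<alpha> * left_part (csharp_of_cov f) (- y))" for y
  have cr: "continuous_on UNIV (right_part (csharp_of_cov f))"
    and cl: "continuous_on UNIV (left_part (csharp_of_cov f))"
    using cinf_parts by (auto simp: cinf_set_def)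
  have cg: "continuous_on UNIV g" unfolding g_def
    by (intro continuous_intros cr continuous_on_compose2[OF cl]) auto
  \<comment> \<open>The integrand of \<open>E_int\<close> takes the dummy value of \<open>f\<close>
    at 0, whereas \<open>g\<close> is continuous there; changing one point leaves the integral
    unchanged.\<close>
  have eq: "E_int \<alpha> \<beta> f = (\<lambda>x. exp (- ?c * x) * integral {0..x} g)"
  proof
    fix x
    have "E_int \<alpha> \<beta> f x = integral {0..x} (\<lambda>y. exp (- ?c * x) * g y)"
      unfolding E_int_def
      by (rule integral_spike[of "{0}"])
         (auto simp: g_def left_part_def right_part_def exp_diff exp_minus field_simps
               simp flip: exp_add)
    then show "E_int \<alpha> \<beta> f x = exp (- ?c * x) * integral {0..x} g" by simp
  qed
  \<comment> \<open>The interval reaches beyond \<open>x\<close>, so the derivative within it is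
    two-sided.\<close>
  have "((\<lambda>x. integral {0..x} g) has_real_derivative g x) (at x within {0..x+1})"
    by (rule integral_has_real_derivative) (use x in \<open>auto intro: continuous_on_subset[OF cg]\<close>)
  then have D: "((\<lambda>x. integral {0..x} g) has_real_derivative g x) (at x)"
    using x by (simp add: at_within_Icc_at)
  have "((\<lambda>x. exp (- ?c * x) * integral {0..x} g) has_real_derivative
      exp (- ?c * x) * g x - ?c * (exp (- ?c * x) * integral {0..x} g)) (at x)"
    by (rule derivative_eq_intros D refl | simp add: algebra_simps)+
  moreover have "exp (- ?c * x) * g x = \<beta> * apply_cov f x - \<alpha> * apply_cov f (- x)"
    using x by (simp add: g_def right_part_def left_part_def flip: mult.assoc exp_add)
      (simp add: algebra_simps)
  ultimately show ?thesis by (simp add: eq)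
qed

lemma E_nonpos: "x \<le> 0 \<Longrightarrow> E_left \<alpha> \<beta> f x = left_part (csharp_of_cov f) x"
  and E_nonneg: "x \<ge> 0 \<Longrightarrow> E_right \<alpha> \<beta> f x = right_part (csharp_of_cov f) x"
  by (auto simp: E_left_def E_right_def left_part_def right_part_def)

text \<open>For \<open>x > 0\<close> the sum \<open>s x\<close> is \<open>2 * cov_plus f * exp (-
  (\<alpha> + \<beta>) * x) + 2 * E_int \<alpha> \<beta> f x\<close>, the variation-of-constants
  solution of the required equation. Since \<open>s\<close> is even and \<open>w\<close> odd,
  negative \<open>x\<close> follow by reflection, and 0 follows by continuity.\<close>

lemma matching_pair_E:
  assumes c: "\<alpha> + \<beta> > 0"
  shows "matching_pair \<alpha> \<beta> (E_left \<alpha> \<beta> f) (E_right \<alpha> \<beta> f)"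
proof -
  let ?P = "E_left \<alpha> \<beta> f" and ?Q = "E_right \<alpha> \<beta> f"
  define s where "s x = ?Q x + ?Q (- x)" for x
  define w where "w x = \<alpha> * (?P x - ?P (- x)) + \<beta> * (?Q x - ?Q (- x))" for x
  have cP: "continuous_on UNIV ?P" and cQ: "continuous_on UNIV ?Q"
    using E_mem[OF c] by (auto simp: cinf_set_def)
  have pos: "(s has_real_derivative w x) (at x)" if x: "x > 0" for x
  proof (rule has_field_derivative_transform_within_open[of _ _ _ "{0<..}"])
    have w: "w x = 2 * (\<beta> * apply_cov f x - \<alpha> * apply_cov f (- x)) -
        (\<alpha> + \<beta>) * (2 * cov_plus f * exp (- (\<alpha> + \<beta>) * x) + 2 * E_int \<alpha> \<beta> f x)"
      using x unfolding w_def E_left_def E_right_def Let_def E_int_def[symmetric]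
      by (simp add: algebra_simps)
    show "((\<lambda>x. 2 * cov_plus f * exp (- (\<alpha> + \<beta>) * x) + 2 * E_int \<alpha> \<beta> f x) has_real_derivative w x) (at x)"
      unfolding w by (rule derivative_eq_intros has_real_derivative_E_int refl x | simp add: algebra_simps)+
  qed (use x in \<open>auto simp: s_def E_right_def E_int_def\<close>)
  have "(s has_real_derivative w x) (at x)" for x
  proof (rule has_real_derivative_at_exceptional_point[of _ _ 0])
    show "continuous_on UNIV s" "continuous_on UNIV w" unfolding s_def w_def
      by (intro continuous_intros continuous_on_compose2[OF cP] continuous_on_compose2[OF cQ]; simp)+
    fix x :: real assume "x \<noteq> 0"
    then consider "x > 0" | "- x > 0" by linarith
    then show "(s has_real_derivative w x) (at x)"
    proof cases
      case 2
      have "s = (\<lambda>x. s (- x))" "w x = - w (- x)" by (auto simp: s_def w_def algebra_simps)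
      then show ?thesis using pos[OF 2] by (metis DERIV_mirror)
    qed (rule pos)
  qed
  moreover have "?P x + ?P (- x) + ?Q x + ?Q (- x) = 0" for x
    by (cases x "0::real" rule: linorder_cases)
       (auto simp: E_left_def E_right_def Let_def cov_plus_eq)
  ultimately show ?thesis by (simp add: matching_pair_def s_def[abs_def] w_def)
qed

text \<open>Uniqueness of matching pairs reduces any identity for \<open>E_perp\<close> to the two
  half-lines where it merely copies \<open>f\<close>, so the integral formulas never have to be
  manipulated again.\<close>

lemma E_perp_eqI:
  assumes ab: "\<alpha> \<ge> 0" "\<beta> \<ge> 0" "\<alpha> + \<beta> > 0"
    and p: "matching_pair \<alpha> \<beta> (apply_cinf (fst p)) (apply_cinf (snd p))"
    and l: "\<And>x. x \<le> 0 \<Longrightarrow> apply_cinf (fst p) x = left_part (csharp_of_cov f) x"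
    and r: "\<And>x. x \<ge> 0 \<Longrightarrow> apply_cinf (snd p) x = right_part (csharp_of_cov f) x"
  shows "E_perp \<alpha> \<beta> f = p"
proof -
  have "apply_cinf (fst p) = E_left \<alpha> \<beta> f" "apply_cinf (snd p) = E_right \<alpha> \<beta> f"
    by (rule matching_pair_unique[OF p matching_pair_E[OF ab(3)] ab(1,2)];
        simp add: l r E_nonpos E_nonneg)+
  then have "Cinf (E_left \<alpha> \<beta> f) = fst p" "Cinf (E_right \<alpha> \<beta> f) = snd p"
    by (metis apply_cinf_inverse)+
  then show ?thesis by (simp add: E_perp_def)
qed

section \<open>Bounds for the extension operator and the intertwining relation\<close>

lemma left_part_add: "left_part (f + g) x = left_part f x + left_part g x"
  and right_part_add: "right_part (f + g) x = right_part f x + right_part g x"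
  and left_part_scale: "left_part (r *\<^sub>R f) x = r * left_part f x"
  and right_part_scale: "right_part (r *\<^sub>R f) x = r * right_part f x"
  by (simp_all add: left_part_def right_part_def plus_csharp.rep_eq scaleR_csharp.rep_eq zero_limits_linear)

lemma abs_parts_le:
  "\<bar>left_part f x\<bar> \<le> norm f" "\<bar>right_part f x\<bar> \<le> norm f"
proof -
  have "\<forall>\<^sub>F x in at_left 0. norm (apply_csharp f x) \<le> norm f"
    "\<forall>\<^sub>F x in at_right 0. norm (apply_csharp f x) \<le> norm f"
    by (auto simp: eventually_at_filter norm_csharp_upper)
  then have "\<bar>zero_minus f\<bar> \<le> norm f" "\<bar>zero_plus f\<bar> \<le> norm f"
    using tendsto_upperbound[OF tendsto_norm[OF tendsto_zero_minus]]
      tendsto_upperbound[OF tendsto_norm[OF tendsto_zero_plus]] by simp_all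
  then show "\<bar>left_part f x\<bar> \<le> norm f" "\<bar>right_part f x\<bar> \<le> norm f"
    by (auto simp: left_part_def right_part_def norm_csharp_upper)
qed

lemma norm_cov_le:
  assumes "\<And>x. x < 0 \<Longrightarrow> \<bar>apply_cov f x\<bar> \<le> B" "\<And>x. x > 0 \<Longrightarrow> \<bar>apply_cov f x\<bar> \<le> B"
  shows "norm f \<le> B"
  unfolding norm_cov.rep_eq norm_csharp.rep_eq
  by (intro cSUP_least punctured_line_nonempty) (use assms in \<open>auto simp: neq_iff\<close>)

lemma bounded_linear_E_perp:
  assumes ab: "\<alpha> \<ge> 0" "\<beta> \<ge> 0" "\<alpha> + \<beta> > 0"
  shows "bounded_linear (E_perp \<alpha> \<beta>)"
proof (rule bounded_linear_intro)
  note apply_E = apply_E_perp[OF ab(3)]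
  fix f g :: cov and r :: real
  show "E_perp \<alpha> \<beta> (f + g) = E_perp \<alpha> \<beta> f + E_perp \<alpha> \<beta> g"
  proof (rule E_perp_eqI[OF ab])
    show "matching_pair \<alpha> \<beta> (apply_cinf (fst (E_perp \<alpha> \<beta> f + E_perp \<alpha> \<beta> g)))
        (apply_cinf (snd (E_perp \<alpha> \<beta> f + E_perp \<alpha> \<beta> g)))"
      by (simp add: plus_cinf.rep_eq apply_E matching_pair_add matching_pair_E ab)
  qed (simp_all add: plus_cinf.rep_eq apply_E E_nonpos E_nonneg plus_cov.rep_eq left_part_add right_part_add)
  show "E_perp \<alpha> \<beta> (r *\<^sub>R f) = r *\<^sub>R E_perp \<alpha> \<beta> f"
  proof (rule E_perp_eqI[OF ab])
    show "matching_pair \<alpha> \<beta> (apply_cinf (fst (r *\<^sub>R E_perp \<alpha> \<beta> f)))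
        (apply_cinf (snd (r *\<^sub>R E_perp \<alpha> \<beta> f)))"
      by (simp add: scaleR_cinf.rep_eq apply_E matching_pair_scale matching_pair_E ab)
  qed (simp_all add: scaleR_cinf.rep_eq apply_E E_nonpos E_nonneg scaleR_cov.rep_eq left_part_scale right_part_scale)
  have "norm (fst (E_perp \<alpha> \<beta> f)) \<le> 3 * norm f" "norm (snd (E_perp \<alpha> \<beta> f)) \<le> 3 * norm f"
    unfolding norm_cov.rep_eq
    by (rule norm_cinf_le, simp add: apply_E,
        rule matching_pair_bound[OF matching_pair_E[OF ab(3)] ab(1,2)];
        simp add: E_nonpos E_nonneg abs_parts_le)+
  \<comment> \<open>Each component contributes a factor 3, and the product norm is at most the sum
    of the component norms.\<close>
  then show "norm (E_perp \<alpha> \<beta> f) \<le> norm f * 6"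
    using norm_Pair_le[of "fst (E_perp \<alpha> \<beta> f)" "snd (E_perp \<alpha> \<beta> f)"] by simp
qed

lemma norm_le_norm_E_perp:
  assumes c: "\<alpha> + \<beta> > 0"
  shows "norm f \<le> norm (E_perp \<alpha> \<beta> f)"
proof (rule norm_cov_le)
  fix x :: real
  show "\<bar>apply_cov f x\<bar> \<le> norm (E_perp \<alpha> \<beta> f)" if "x < 0"
    using norm_cinf_upper[of "fst (E_perp \<alpha> \<beta> f)" x] norm_fst_le[where x = "fst (E_perp \<alpha> \<beta> f)" and y = "snd (E_perp \<alpha> \<beta> f)"] that
    by (simp add: apply_E_perp[OF c] E_left_def)
  show "\<bar>apply_cov f x\<bar> \<le> norm (E_perp \<alpha> \<beta> f)" if "x > 0"
    using norm_cinf_upper[of "snd (E_perp \<alpha> \<beta> f)" x] norm_snd_le[where x = "fst (E_perp \<alpha> \<beta> f)" and y = "snd (E_perp \<alpha> \<beta> f)"] that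
    by (simp add: apply_E_perp[OF c] E_right_def)
qed

text \<open>\<open>C_D t\<close> averages two opposite shifts, so it maps matching pairs to matching
  pairs, and \<open>R_op\<close> reads off precisely the two halves that determine such a
  pair.\<close>

lemma E_perp_Cos_perp:
  assumes ab: "\<alpha> \<ge> 0" "\<beta> \<ge> 0" "\<alpha> + \<beta> > 0"
  shows "E_perp \<alpha> \<beta> (Cos_perp \<alpha> \<beta> t f) = C_D t (E_perp \<alpha> \<beta> f)"
proof (rule E_perp_eqI[OF ab])
  let ?p = "C_D t (E_perp \<alpha> \<beta> f)"
  have "apply_cinf (fst ?p) = (\<lambda>x. 1/2 * (E_left \<alpha> \<beta> f (x + t) + E_left \<alpha> \<beta> f (x - t)))"
    "apply_cinf (snd ?p) = (\<lambda>x. 1/2 * (E_right \<alpha> \<beta> f (x + t) + E_right \<alpha> \<beta> f (x - t)))"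
    by (simp_all add: C_D_def case_prod_beta basic_cosine.rep_eq apply_E_perp[OF ab(3)])
  then show "matching_pair \<alpha> \<beta> (apply_cinf (fst ?p)) (apply_cinf (snd ?p))"
    by (simp only: matching_pair_scale matching_pair_translates matching_pair_E[OF ab(3)])
  \<comment> \<open>At \<open>x = 0\<close> the left part takes the one-sided limit, not the dummy
    value, so \<open>R_op_one_sided_limits\<close> is applied.\<close>
  show "apply_cinf (fst ?p) x = left_part (csharp_of_cov (Cos_perp \<alpha> \<beta> t f)) x" if "x \<le> 0" for x
    using that by (simp add: csharp_of_Cos_perp[OF ab(3)] left_part_def R_op_one_sided_limits)
      (simp add: R_op_def case_prod_beta glue.rep_eq)
  show "apply_cinf (snd ?p) x = right_part (csharp_of_cov (Cos_perp \<alpha> \<beta> t f)) x" if "x \<ge> 0" for x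
    using that by (simp add: csharp_of_Cos_perp[OF ab(3)] right_part_def R_op_one_sided_limits)
      (simp add: R_op_def case_prod_beta glue.rep_eq)
qed

section \<open>The generator\<close>

lemma C2_on_unique:
  assumes S: "convex S" "a \<in> S" and g: "C2_on S g g1 k" and h: "C2_on S h h1 k"
    and a: "g a = h a" "g1 a = h1 a" and x: "x \<in> S"
  shows "g x = h x"
proof -
  have "\<exists>c. \<forall>x\<in>S. g1 x - h1 x = c"
    by (rule has_field_derivative_zero_constant[OF S(1)])
       (use g h in \<open>auto simp: C2_on_def intro!: derivative_eq_intros\<close>)
  then obtain c where "\<And>x. x \<in> S \<Longrightarrow> g1 x - h1 x = c" by blast
  then have eq: "g1 y = h1 y" if "y \<in> S" for y using a(2) S(2) that by (metis eq_iff_diff_eq_0)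
  have "\<exists>c. \<forall>x\<in>S. g x - h x = c"
    by (rule has_field_derivative_zero_constant[OF S(1)])
       (use g h eq in \<open>auto simp: C2_on_def intro!: derivative_eq_intros\<close>)
  then obtain c where "\<And>x. x \<in> S \<Longrightarrow> g x - h x = c" by blast
  then show ?thesis using a(1) S(2) x by (metis eq_iff_diff_eq_0)
qed

lemma C2_on_restrict:
  assumes "\<And>x. (g has_real_derivative g1 x) (at x)" "\<And>x. (g1 has_real_derivative g2 x) (at x)"
    and "continuous_on UNIV g2"
    and "\<And>x. x \<in> S \<Longrightarrow> h x = g x" "\<And>x. x \<in> S \<Longrightarrow> h2 x = g2 x"
  shows "C2_on S h g1 h2"
  unfolding C2_on_def
proof (intro conjI ballI)
  fix x assume x: "x \<in> S"
  show "(h has_real_derivative g1 x) (at x within S)"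
    by (rule has_field_derivative_transform_within[OF has_field_derivative_at_within[OF assms(1)], of 1])
       (use x assms(4) in auto)
  show "(g1 has_real_derivative h2 x) (at x within S)"
    using has_field_derivative_at_within[OF assms(2)] by (simp add: assms(5) x)
next
  show "continuous_on S h2"
    using continuous_on_subset[OF assms(3)] by (rule continuous_on_eq) (auto simp: assms(5))
qed

text \<open>Differentiability of \<open>Q\<close> identifies the left side of the second relation as
  \<open>Q1 x - Q1 (- x)\<close>. Differentiating once more at 0 doubles every term and yields the
  boundary condition.\<close>

lemma matching_pair_deriv_at_0:
  assumes Y: "matching_pair \<alpha> \<beta> P Q"
    and P: "\<And>x. (P has_real_derivative P1 x) (at x)" and Q: "\<And>x. (Q has_real_derivative Q1 x) (at x)"
    and Q1: "(Q1 has_real_derivative q) (at 0)"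
  shows "q = \<alpha> * P1 0 + \<beta> * Q1 0"
proof -
  note mirror = DERIV_mirror[THEN iffD1]
  have "Q1 x - Q1 (- x) = \<alpha> * (P x - P (- x)) + \<beta> * (Q x - Q (- x))" for x
  proof (rule DERIV_unique)
    show "((\<lambda>x. Q x + Q (- x)) has_real_derivative Q1 x - Q1 (- x)) (at x)"
      using DERIV_add[OF Q[of x] mirror[OF Q[of "- x"]]] by simp
    show "((\<lambda>x. Q x + Q (- x)) has_real_derivative
        \<alpha> * (P x - P (- x)) + \<beta> * (Q x - Q (- x))) (at x)"
      using Y by (simp add: matching_pair_def)
  qed
  moreover have "((\<lambda>x. Q1 x - Q1 (- x)) has_real_derivative 2 * q) (at 0)"
    using DERIV_diff[OF Q1 DERIV_mirror[where f = Q1 and x = 0 and y = q, THEN iffD1]] Q1 by simp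
  ultimately have "((\<lambda>x. \<alpha> * (P x - P (- x)) + \<beta> * (Q x - Q (- x))) has_real_derivative 2 * q) (at 0)"
    by simp
  moreover have "((\<lambda>x. \<alpha> * (P x - P (- x)) + \<beta> * (Q x - Q (- x))) has_real_derivative
      \<alpha> * (P1 0 - - P1 0) + \<beta> * (Q1 0 - - Q1 0)) (at 0)"
    using mirror[OF P[of "- 0"]] mirror[OF Q[of "- 0"]]
    by (intro DERIV_add DERIV_cmult DERIV_diff P Q) simp_all
  ultimately have "2 * q = \<alpha> * (P1 0 - - P1 0) + \<beta> * (Q1 0 - - Q1 0)" by (rule DERIV_unique)
  then show ?thesis by (simp add: algebra_simps)
qed

text \<open>The defects of the two relations have zero second derivative because \<open>P2\<close>
  and \<open>Q2\<close> match. The defect of the first has value \<open>2 * (P 0 + Q 0)\<close> and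
  slope 0 at 0; that of the second has value 0 and slope
  \<open>2 * (Q2 0 - \<alpha> * P1 0 - \<beta> * Q1 0)\<close>. Both therefore vanish
  identically.\<close>

lemma matching_pair_antiderivative2:
  assumes Y: "matching_pair \<alpha> \<beta> P2 Q2"
    and P: "\<And>x. (P has_real_derivative P1 x) (at x)" "\<And>x. (P1 has_real_derivative P2 x) (at x)"
    and Q: "\<And>x. (Q has_real_derivative Q1 x) (at x)" "\<And>x. (Q1 has_real_derivative Q2 x) (at x)"
    and zero: "P 0 + Q 0 = 0" "Q2 0 = \<alpha> * P1 0 + \<beta> * Q1 0"
  shows "matching_pair \<alpha> \<beta> P Q"
proof -
  have mirror: "((\<lambda>x. h (- x)) has_real_derivative - h' (- x)) (at x)"
    if "\<And>x. (h has_real_derivative h' x) (at x)" for h h' :: "real \<Rightarrow> real" and x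
    using that[of "- x"] by (simp add: DERIV_mirror)
  note d = P Q P[THEN mirror] Q[THEN mirror]
  have affine: "u x = 0"
    if u: "\<And>x. (u has_real_derivative u1 x) (at x)" "\<And>x. (u1 has_real_derivative 0) (at x)"
      "u 0 = 0" "u1 0 = 0" for u u1 :: "real \<Rightarrow> real" and x
  proof -
    have "u1 x = 0" for x using DERIV_isconst_all[of u1 x 0] u by simp
    then show ?thesis using DERIV_isconst_all[of u x 0] u by simp
  qed
  have Y2: "P2 x + P2 (- x) + Q2 x + Q2 (- x) = 0"
    "((\<lambda>x. Q2 x + Q2 (- x)) has_real_derivative
        \<alpha> * (P2 x - P2 (- x)) + \<beta> * (Q2 x - Q2 (- x))) (at x)" for x
    using Y by (simp_all add: matching_pair_def)
  have sum: "P x + P (- x) + Q x + Q (- x) = 0" for x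
  proof (rule affine[where u = "\<lambda>x. P x + P (- x) + Q x + Q (- x)"])
    fix x
    show "((\<lambda>x. P x + P (- x) + Q x + Q (- x)) has_real_derivative
        P1 x - P1 (- x) + Q1 x - Q1 (- x)) (at x)"
      by (rule derivative_eq_intros d refl | simp)+
    show "((\<lambda>x. P1 x - P1 (- x) + Q1 x - Q1 (- x)) has_real_derivative 0) (at x)"
      using Y2(1)[of x] by (auto intro!: derivative_eq_intros d)
  qed (use zero in simp_all)
  have "Q1 x - Q1 (- x) - (\<alpha> * (P x - P (- x)) + \<beta> * (Q x - Q (- x))) = 0" for x
  proof (rule affine[where
        u = "\<lambda>x. Q1 x - Q1 (- x) - (\<alpha> * (P x - P (- x)) + \<beta> * (Q x - Q (- x)))"])
    fix x
    show "((\<lambda>x. Q1 x - Q1 (- x) - (\<alpha> * (P x - P (- x)) + \<beta> * (Q x - Q (- x)))) has_real_derivative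
        Q2 x + Q2 (- x) - (\<alpha> * (P1 x + P1 (- x)) + \<beta> * (Q1 x + Q1 (- x)))) (at x)"
      by (rule derivative_eq_intros d refl | simp)+
    \<comment> \<open>Differentiability of \<open>Q2\<close> itself is not assumed; that of the sum
      \<open>Q2 x + Q2 (- x)\<close> comes from the second relation.\<close>
    show "((\<lambda>x. Q2 x + Q2 (- x) - (\<alpha> * (P1 x + P1 (- x)) + \<beta> * (Q1 x + Q1 (- x))))
        has_real_derivative 0) (at x)"
      by (rule derivative_eq_intros d Y2(2) refl | simp)+
  qed (use zero in simp_all)
  then have "((\<lambda>x. Q x + Q (- x)) has_real_derivative
      \<alpha> * (P x - P (- x)) + \<beta> * (Q x - Q (- x))) (at x)" for x
    using DERIV_add[OF d(3)[of x] d(7)[of x]] by simp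
  with sum show ?thesis by (simp add: matching_pair_def)
qed

lemma A_perp_iff:
  assumes ab: "\<alpha> \<ge> 0" "\<beta> \<ge> 0" "\<alpha> + \<beta> > 0"
  shows "(f, g) \<in> A_perp \<alpha> \<beta> \<longleftrightarrow> (\<exists>P1 Q1. \<forall>x.
      (E_left \<alpha> \<beta> f has_real_derivative P1 x) (at x) \<and> (P1 has_real_derivative E_left \<alpha> \<beta> g x) (at x) \<and>
      (E_right \<alpha> \<beta> f has_real_derivative Q1 x) (at x) \<and> (Q1 has_real_derivative E_right \<alpha> \<beta> g x) (at x))"
proof
  let ?P = "E_left \<alpha> \<beta> f" and ?Q = "E_right \<alpha> \<beta> f" and ?P2 = "E_left \<alpha> \<beta> g" and ?Q2 = "E_right \<alpha> \<beta> g"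
  let ?l = "left_part (csharp_of_cov f)" and ?r = "right_part (csharp_of_cov f)"
  have c2: "continuous_on UNIV ?P2" "continuous_on UNIV ?Q2"
    and lim2: "\<exists>L. (?P2 \<longlongrightarrow> L) at_bot" "\<exists>L. (?Q2 \<longlongrightarrow> L) at_top"
    using E_mem[OF ab(3)] by (auto simp: cinf_set_def)
  {
    assume "\<exists>P1 Q1. \<forall>x.
      (?P has_real_derivative P1 x) (at x) \<and> (P1 has_real_derivative ?P2 x) (at x) \<and>
      (?Q has_real_derivative Q1 x) (at x) \<and> (Q1 has_real_derivative ?Q2 x) (at x)"
    then obtain P1 Q1 where P: "\<And>x. (?P has_real_derivative P1 x) (at x)"
      "\<And>x. (P1 has_real_derivative ?P2 x) (at x)"
      and Q: "\<And>x. (?Q has_real_derivative Q1 x) (at x)" "\<And>x. (Q1 has_real_derivative ?Q2 x) (at x)"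
      by blast
    have l: "C2_on {..0} ?l P1 ?P2"
      by (rule C2_on_restrict[OF P c2(1)]) (auto simp: E_nonpos)
    have r: "C2_on {0..} ?r Q1 ?Q2"
      by (rule C2_on_restrict[OF Q c2(2)]) (auto simp: E_nonneg)
    have "?Q2 0 = \<alpha> * P1 0 + \<beta> * Q1 0"
      by (rule matching_pair_deriv_at_0[OF matching_pair_E[OF ab(3)] P(1) Q])
    moreover have "?Q2 0 = - ?P2 0" by (simp add: E_left_def E_right_def cov_plus_eq)
    ultimately have "f \<in> A_perp_domain \<alpha> \<beta>"
      unfolding A_perp_domain_def using l r lim2 by blast
    moreover have "apply_cov g x = deriv (deriv (apply_cov f)) x" if "x \<noteq> 0" for x
    proof (cases "x < 0")
      case True
      have "deriv (deriv (apply_cov f)) x = ?P2 x"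
        by (rule C2_on_deriv2[OF l, of "{..<0}"]) (use True in \<open>auto simp: left_part_def\<close>)
      then show ?thesis using True by (simp add: E_left_def)
    next
      case False
      then have "x > 0" using that by simp
      have "deriv (deriv (apply_cov f)) x = ?Q2 x"
        by (rule C2_on_deriv2[OF r, of "{0<..}"]) (use \<open>x > 0\<close> in \<open>auto simp: right_part_def\<close>)
      then show ?thesis using \<open>x > 0\<close> by (simp add: E_right_def)
    qed
    ultimately show "(f, g) \<in> A_perp \<alpha> \<beta>" by (simp add: A_perp_def)
  }
  {
    assume "(f, g) \<in> A_perp \<alpha> \<beta>"
    then obtain l1 l2 r1 r2 where l: "C2_on {..0} ?l l1 l2" and r: "C2_on {0..} ?r r1 r2"
      and bc: "r2 0 = \<alpha> * l1 0 + \<beta> * r1 0"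
      and g: "\<And>x. x \<noteq> 0 \<Longrightarrow> apply_cov g x = deriv (deriv (apply_cov f)) x"
      by (auto simp: A_perp_def A_perp_domain_def)
    have l2: "l2 x = apply_cov g x" if "x < 0" for x
      using C2_on_deriv2[OF l, of "{..<0}" x "apply_cov f"] g that by (simp add: left_part_def subset_eq)
    have r2: "r2 x = apply_cov g x" if "x > 0" for x
      using C2_on_deriv2[OF r, of "{0<..}" x "apply_cov f"] g that by (simp add: right_part_def subset_eq)
    \<comment> \<open>The graph fixes \<open>g\<close> only off 0; continuity of \<open>l2\<close>
      up to the end-point supplies the value there.\<close>
    have "l2 0 = cov_minus g"
    proof (rule tendsto_unique[OF trivial_limit_at_left_real _ tendsto_zero_minus])
      have "(l2 \<longlongrightarrow> l2 0) (at 0 within {..0})" using l by (simp add: C2_on_def continuous_on_def)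
      then have "(l2 \<longlongrightarrow> l2 0) (at_left 0)" by (rule tendsto_within_subset) auto
      then show "(apply_cov g \<longlongrightarrow> l2 0) (at_left 0)"
        by (rule tendsto_at_left_within[rotated]) (simp add: l2)
    qed
    then have l2': "l2 x = ?P2 x" if "x \<le> 0" for x using that l2 by (auto simp: E_left_def)
    have "r2 0 = cov_plus g"
    proof (rule tendsto_unique[OF trivial_limit_at_right_real _ tendsto_zero_plus])
      have "(r2 \<longlongrightarrow> r2 0) (at 0 within {0..})" using r by (simp add: C2_on_def continuous_on_def)
      then have "(r2 \<longlongrightarrow> r2 0) (at_right 0)" by (rule tendsto_within_subset) auto
      then show "(apply_cov g \<longlongrightarrow> r2 0) (at_right 0)"
        by (rule tendsto_at_right_within[rotated]) (simp add: r2)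
    qed
    then have r2': "r2 x = ?Q2 x" if "x \<ge> 0" for x using that r2 by (auto simp: E_right_def)
    have antiderivative2: "\<exists>h h1. h 0 = a \<and> h1 0 = b \<and>
        (\<forall>x. (h has_real_derivative h1 x) (at x)) \<and> (\<forall>x. (h1 has_real_derivative k x) (at x))"
      if k: "continuous_on UNIV k" for k :: "real \<Rightarrow> real" and a b
    proof -
      obtain h1 where h1: "h1 0 = b" "\<And>x. (h1 has_real_derivative k x) (at x)"
        using ex_antiderivative[OF k] by blast
      then have "continuous_on UNIV h1" by (meson DERIV_isCont continuous_at_imp_continuous_on)
      then show ?thesis using ex_antiderivative[of h1 0 a] h1 by blast
    qed
    \<comment> \<open>The initial data are the one-sided values and slopes of \<open>f\<close> at 0,
      so that \<open>P\<close> and \<open>Q\<close> reproduce \<open>f\<close> on their own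
      half-lines.\<close>
    obtain P P1 where P: "P 0 = cov_minus f" "P1 0 = l1 0"
      "\<And>x. (P has_real_derivative P1 x) (at x)" "\<And>x. (P1 has_real_derivative ?P2 x) (at x)"
      using antiderivative2[OF c2(1)] by blast
    obtain Q Q1 where Q: "Q 0 = cov_plus f" "Q1 0 = r1 0"
      "\<And>x. (Q has_real_derivative Q1 x) (at x)" "\<And>x. (Q1 has_real_derivative ?Q2 x) (at x)"
      using antiderivative2[OF c2(2)] by blast
    \<comment> \<open>The condition \<open>f(0+) = - f(0-)\<close> and the boundary condition are
      exactly the two initial conditions required.\<close>
    have Y: "matching_pair \<alpha> \<beta> P Q"
      by (rule matching_pair_antiderivative2[OF matching_pair_E[OF ab(3)] P(3,4) Q(3,4)])
         (use bc r2'[of 0] in \<open>simp_all add: P Q cov_plus_eq\<close>)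
    have Pl: "P x = ?P x" if "x \<le> 0" for x
    proof -
      have "C2_on {..0} P P1 l2" by (rule C2_on_restrict[OF P(3,4) c2(1)]) (auto simp: l2')
      then have "P x = ?l x"
        using C2_on_unique[of "{..0}" 0 P P1 l2 ?l l1 x] l that by (simp add: P left_part_def)
      then show ?thesis using that by (simp add: E_nonpos)
    qed
    have Qr: "Q x = ?Q x" if "x \<ge> 0" for x
    proof -
      have "C2_on {0..} Q Q1 r2" by (rule C2_on_restrict[OF Q(3,4) c2(2)]) (auto simp: r2')
      then have "Q x = ?r x"
        using C2_on_unique[of "{0..}" 0 Q Q1 r2 ?r r1 x] r that by (simp add: Q right_part_def)
      then show ?thesis using that by (simp add: E_nonneg)
    qed
    have "P = ?P" "Q = ?Q"
      using matching_pair_unique[OF Y matching_pair_E[OF ab(3)] ab(1,2) Pl Qr] by blast+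
    then show "\<exists>P1 Q1. \<forall>x.
      (?P has_real_derivative P1 x) (at x) \<and> (P1 has_real_derivative ?P2 x) (at x) \<and>
      (?Q has_real_derivative Q1 x) (at x) \<and> (Q1 has_real_derivative ?Q2 x) (at x)"
      using P Q by blast
  }
qed

theorem theorem4p8:
  fixes \<alpha> \<beta> :: real
  assumes "\<alpha> \<ge> 0" and "\<beta> \<ge> 0" and "\<alpha> + \<beta> > 0"
  shows "(\<forall>t f. csharp_of_cov (Cos_perp \<alpha> \<beta> t f) = R_op (C_D t (E_perp \<alpha> \<beta> f))) \<and>
         generates_cosine_family (A_perp \<alpha> \<beta>) (Cos_perp \<alpha> \<beta>)"
proof -
  have C_D: "C_D = (\<lambda>t (f, g). (basic_cosine t f, basic_cosine t g))"
    by (simp add: fun_eq_iff C_D_def)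
  have "cosine_family C_D"
    unfolding C_D by (intro cosine_family_prod cosine_family_basic)
  note pullback = cosine_family_pullback[of C_D "E_perp \<alpha> \<beta>" "Cos_perp \<alpha> \<beta>" 1,
      OF this bounded_linear_E_perp[OF assms] E_perp_Cos_perp[OF assms]]
  have below: "norm f \<le> 1 * norm (E_perp \<alpha> \<beta> f)" for f
    using norm_le_norm_E_perp[OF assms(3)] by simp
  have "(E_perp \<alpha> \<beta> f, E_perp \<alpha> \<beta> g) \<in> cosine_generator C_D \<longleftrightarrow> (f, g) \<in> A_perp \<alpha> \<beta>" for f g
    using cosine_generator_prod[of "fst (E_perp \<alpha> \<beta> f)" "snd (E_perp \<alpha> \<beta> f)"
        "fst (E_perp \<alpha> \<beta> g)" "snd (E_perp \<alpha> \<beta> g)" basic_cosine basic_cosine]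
    unfolding C_D A_perp_iff[OF assms] cosine_generator_basic apply_E_perp[OF assms(3)] prod.collapse
    by blast
  then have "cosine_generator (Cos_perp \<alpha> \<beta>) = A_perp \<alpha> \<beta>"
    using pullback(2)[OF below] by auto
  \<comment> \<open>\<open>Cos_perp\<close> is built with the abstraction map \<open>Cov\<close>;
    \<open>csharp_of_Cos_perp\<close> confirms that the glued function lies in the subspace, so the
    stated formula holds literally.\<close>
  with pullback(1)[OF below] show ?thesis
    by (simp add: generates_cosine_family_def csharp_of_Cos_perp[OF assms(3)])
qed

end
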